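(* For all $t>0$ and $x>0$, $$P[\sigma_M<t\mid M=x] = P^*[\tau_x < t ] = e^{\delta x} \Phi\Big(-\frac{x}{\sqrt{t}} -\frac{\delta}{2} \sqrt{t} \Big) +\Phi \Big(-\frac{x}{\sqrt{t}} +\frac{\delta}{2} \sqrt{t} \Big).$$ Moreover, the conditional density function of $\sigma_M$ given $M=x$ is $$f_{\sigma_M|M} (t|x) = \frac{x}{t^{3/2} }\, \phi \Big(-\frac{x}{\sqrt{t}} +\frac{\delta}{2} \sqrt{t}\Big),\qquad t>0,$$ and the joint density function of $(\sigma_M, M)$ is $$f(t, x) =\frac{\delta x}{t^{3/2}}\, \phi \Big(\frac{x}{\sqrt{t}} +\frac{\delta}{2} \sqrt{t}\Big),\qquad t>0,\ x>0.$$
   Context: Let $\delta>0$. $\{W_t\}_{t\ge 0}$ is a Brownian motion with $W_0=0$ and variance $1$ per unit time. Under $P$ it has drift $-\delta/2$; under $P^*$ it has drift $+\delta/2$. Under $P$, set $M=\sup_{0\leq t<\infty}W_t$ and let $\sigma_M=\operatorname{argsup}_{0\leq t<\infty}W_t$ be the (a.s. unique) time at which the supremum is attained. For $x>0$, $\tau_x=\inf\{t>0: W_t>x\}$. $P[\,\cdot\mid M=x]$ denotes the regular conditional distribution given $M=x$ under $P$ (the stated formula being a version of it). $\Phi$ and $\phi$ are the standard normal cdf and density. *)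

theory Defs
  imports "HOL-Probability.Probability"
begin

(* Only times t \<ge> 0 are constrained; the values of W at negative times play no role.
   Paths are continuous for every outcome, not just almost surely, so that path functionals such
   as the supremum are measurable on a probability space that need not be complete. *)
locale brownian_motion = prob_space P
  for P :: "'a measure" +
  fixes W :: "real \<Rightarrow> 'a \<Rightarrow> real"
    and \<mu> :: real  \<comment> \<open>drift; the variance per unit time is 1\<close>
  assumes measurable_W: "\<And>t. 0 \<le> t \<Longrightarrow> W t \<in> borel_measurable P"
    and start_zero: "AE \<omega> in P. W 0 \<omega> = 0"
    and continuous_paths: "\<And>\<omega>. \<omega> \<in> space P \<Longrightarrow> continuous_on {0..} (\<lambda>t. W t \<omega>)"
    and normal_increments: "\<And>s t. 0 \<le> s \<Longrightarrow> s < t \<Longrightarrow>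
      distributed P lborel (\<lambda>\<omega>. W t \<omega> - W s \<omega>) (normal_density (\<mu> * (t - s)) (sqrt (t - s)))"
    and indep_increments: "\<And>(n::nat) (ts :: nat \<Rightarrow> real). 0 \<le> ts 0 \<Longrightarrow> strict_mono ts \<Longrightarrow>
      indep_vars (\<lambda>_. borel) (\<lambda>i \<omega>. W (ts (Suc i)) \<omega> - W (ts i) \<omega>) {..<n}"

(* Real-valued; on paths that are not bounded above (a null set when the drift is negative)
   the value is an unspecified constant. *)
definition path_sup :: "(real \<Rightarrow> 'a \<Rightarrow> real) \<Rightarrow> 'a \<Rightarrow> real" where
  "path_sup W \<omega> = (SUP t\<in>{0..}. W t \<omega>)"

(* The maximiser is almost surely unique when the drift is negative.  Taking the first one fixes a
   measurable choice on the exceptional null set, which THE would not. *)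
definition path_argsup :: "(real \<Rightarrow> 'a \<Rightarrow> real) \<Rightarrow> 'a \<Rightarrow> real" where
  "path_argsup W \<omega> = Inf {t. is_arg_max (\<lambda>t. W t \<omega>) (\<lambda>t. 0 \<le> t) t}"

(* Extended-real valued: the infimum of the empty set is \<infinity>. *)
definition passage_time :: "(real \<Rightarrow> 'a \<Rightarrow> real) \<Rightarrow> real \<Rightarrow> 'a \<Rightarrow> ereal" where
  "passage_time W x \<omega> = (INF t\<in>{t. 0 < t \<and> W t \<omega> > x}. ereal t)"

(* K is a version of the regular conditional distribution of X given Y under P:
   K y plays the role of P[X \<in> \<cdot> | Y = y]. *)
definition regular_cond_distr ::
  "'a measure \<Rightarrow> 'b measure \<Rightarrow> ('a \<Rightarrow> 'b) \<Rightarrow> 'c measure \<Rightarrow> ('a \<Rightarrow> 'c) \<Rightarrow> ('c \<Rightarrow> 'b measure) \<Rightarrow> bool"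
where
  "regular_cond_distr P N X L Y K \<longleftrightarrow>
     X \<in> P \<rightarrow>\<^sub>M N \<and> Y \<in> P \<rightarrow>\<^sub>M L \<and> K \<in> L \<rightarrow>\<^sub>M prob_algebra N \<and>
     (\<forall>A\<in>sets N. \<forall>B\<in>sets L.
        emeasure P {\<omega> \<in> space P. X \<omega> \<in> A \<and> Y \<omega> \<in> B}
          = (\<integral>\<^sup>+y\<in>B. emeasure (K y) A \<partial>distr P L Y))"

abbreviation std_normal_cdf :: "real \<Rightarrow> real" where
  "std_normal_cdf \<equiv> cdf std_normal_distribution"

end

theory Submission
  imports Defs "HOL-Real_Asymp.Real_Asymp"
begin

text \<open>
  Let \<open>\<mu> < 0\<close> be the drift under \<open>P\<close> (so \<open>\<delta> = - 2 \<mu>\<close>), let \<open>m_t\<close> be the maximum of the path over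
  \<open>[0, t]\<close>, and let \<open>R_t\<close> be the supremum of \<open>W (t + s) - W t\<close> over \<open>s \<ge> 0\<close>.  The maximum is
  attained by time \<open>t\<close> exactly when \<open>R_t \<le> m_t - W t\<close>, and then \<open>M = m_t\<close>.  Since \<open>R_t\<close> is
  independent of the past and exponential with rate \<open>\<delta>\<close>,
  \<open>P (\<sigma>_M \<le> t, M > x) = P (m_t > x) - E (exp (\<delta> W_t) exp (- \<delta> m_t); m_t > x)\<close>.

  Both terms need the joint behaviour of \<open>m_t\<close> and \<open>W_t\<close> only through \<open>E (exp (a W_t); m_t > x)\<close>, which
  the reflection principle gives (\<open>nn_integral_exceeds_exp_W\<close>).  The principle is used directly for
  the process with drift: reflecting a Gaussian increment \<open>D\<close> of drift \<open>\<mu>\<close> costs the density factor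
  \<open>exp (- 2 \<mu> D)\<close>.  With \<open>F \<mu> x t\<close> the explicit distribution function \<open>passage_cdf\<close>, it yields
  \<open>P (m_t > x) = F \<mu> x t\<close> for every drift \<open>\<mu>\<close>, which under \<open>P*\<close> is the law of the passage time,
  and \<open>E (exp (- 2 \<mu> W_t); m_t > x) = F (- \<mu>) x t = exp (\<delta> x) F \<mu> x t\<close>.  The second
  identity plays the part of a change of measure between \<open>P\<close> and \<open>P*\<close>.

  Writing \<open>exp (- \<delta> m)\<close> as \<open>exp (- \<delta> x)\<close> minus the integral of \<open>\<delta> exp (- \<delta> y)\<close> over \<open>x < y < m\<close>, Fubini
  makes the boundary terms cancel and leaves
  \<open>P (\<sigma>_M \<le> t, M > x) = \<integral>_x^\<infinity> \<delta> exp (- \<delta> y) F (\<delta> / 2) y t dy\<close>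
  (\<open>emeasure_run_max_final\<close>).  This shows at once that \<open>M\<close> is exponential, that the law of
  \<open>\<sigma>_M\<close> given \<open>M = y\<close> is the passage time law \<open>F (\<delta> / 2) y\<close>, and, by differentiating \<open>F\<close> in time,
  what the densities are.

  The reflection step and the independence of past and future are exact for the process sampled at
  the points \<open>k t / 2 ^ N\<close>, where only finitely many independent increments matter; continuity of the
  paths carries them to the limit.
\<close>

section \<open>Gaussian integrals and the passage time distribution function\<close>

text \<open>Completing the square: weighting a normal density by \<open>exp (c y)\<close> moves its mean, up to a constant factor.  Every
  expectation of \<open>exp (c W_t)\<close> on a half line is thereby a normal tail.\<close>
lemma tilted_normal_density:
  assumes "0 < s"
  shows "normal_density m s y * exp (c * y)
    = exp (c * m + c\<^sup>2 * s\<^sup>2 / 2) * normal_density (m + c * s\<^sup>2) s y"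
proof -
  have "- (y - m)\<^sup>2 / (2 * s\<^sup>2) + c * y
      = c * m + c\<^sup>2 * s\<^sup>2 / 2 + (- (y - (m + c * s\<^sup>2))\<^sup>2 / (2 * s\<^sup>2))"
  proof -
    define v where "v = s\<^sup>2"
    have "v > 0" using assms by (simp add: v_def)
    then show ?thesis
      unfolding v_def[symmetric] by (simp add: power2_eq_square field_simps)
  qed
  then show ?thesis
    unfolding normal_density_def by (simp add: exp_add[symmetric] algebra_simps)
qed

lemma nn_integral_normal_tail:
  assumes "0 < s"
  shows "(\<integral>\<^sup>+y. ennreal (normal_density m s y) * indicator {x<..} y \<partial>lborel)
    = ennreal (std_normal_cdf ((m - x) / s))"
proof -
  let ?N = "density lborel (\<lambda>y. ennreal (normal_density m s y))"
  interpret N: prob_space ?N by (rule prob_space_normal_density[OF assms])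
  interpret D: real_distribution std_normal_distribution by (rule real_dist_normal_dist)
  have "distributed ?N lborel (\<lambda>y. y) (\<lambda>y. ennreal (normal_density m s y))"
    unfolding distributed_def by (auto intro!: measure_eqI simp: emeasure_distr emeasure_density)
  from N.normal_density_affine[OF this assms, of "- 1 / s" "m / s"]
  have Z: "distributed ?N lborel (\<lambda>y. (m - y) / s) (\<lambda>y. ennreal (std_normal_density y))"
    using assms by (simp add: diff_divide_distrib)
  have "(\<integral>\<^sup>+y. ennreal (normal_density m s y) * indicator {x<..} y \<partial>lborel) = emeasure ?N {x<..}"
    by (simp add: emeasure_density)
  also have "\<dots> = emeasure ?N ((\<lambda>y. (m - y) / s) -` {..<(m - x) / s} \<inter> space ?N)"
    using assms by (intro arg_cong[where f = "emeasure ?N"]) (auto simp: field_simps)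
  also have "\<dots> = emeasure (distr ?N lborel (\<lambda>y. (m - y) / s)) {..<(m - x) / s}"
    by (subst emeasure_distr) auto
  also have "\<dots> = emeasure std_normal_distribution {..<(m - x) / s}"
    using Z by (simp add: distributed_def)
  also have "\<dots> = emeasure std_normal_distribution {..(m - x) / s}"
  proof (rule emeasure_eq_AE)
    show "AE y in std_normal_distribution. (y \<in> {..<(m - x) / s}) = (y \<in> {..(m - x) / s})"
      by (subst AE_density) (use AE_lborel_singleton[of "(m - x) / s"] in \<open>auto elim: eventually_mono\<close>)
  qed auto
  finally show ?thesis by (simp add: cdf_def2 D.emeasure_eq_measure)
qed

text \<open>The fundamental theorem of calculus on \<open>[z - 1, y]\<close>; the left end point is arbitrary, it only has
  to lie below \<open>z\<close>.\<close>
lemma DERIV_std_normal_cdf: "DERIV std_normal_cdf z :> std_normal_density z"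
proof -
  interpret D: real_distribution std_normal_distribution by (rule real_dist_normal_dist)
  have cont: "continuous_on A std_normal_density" for A
    unfolding std_normal_density_def by (intro continuous_intros) auto
  have *: "std_normal_cdf y = std_normal_cdf (z - 1) + integral {z - 1..y} std_normal_density"
    if "z - 1 \<le> y" for y
  proof (cases "z - 1 = y")
    case False
    then have "z - 1 < y" using that by simp
    then have "std_normal_cdf y - std_normal_cdf (z - 1) = measure std_normal_distribution {z - 1<..y}"
      by (rule D.cdf_diff_eq)
    also have "\<dots> = set_lebesgue_integral lborel {z - 1<..y} std_normal_density"
    proof -
      have "measure std_normal_distribution {z - 1<..y}
          = integral\<^sup>L std_normal_distribution (indicator {z - 1<..y})"
        by simp
      also have "\<dots> = (\<integral>w. std_normal_density w *\<^sub>R indicator {z - 1<..y} w \<partial>lborel)"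
        by (rule integral_density) auto
      finally show ?thesis by (simp add: set_lebesgue_integral_def mult.commute)
    qed
    also have "\<dots> = integral {z - 1<..y} std_normal_density"
    proof (rule set_borel_integral_eq_integral(2))
      show "set_integrable lborel {z - 1<..y} std_normal_density"
        unfolding set_integrable_def by (rule integrable_mult_indicator) auto
    qed
    also have "\<dots> = integral {z - 1..y} std_normal_density"
      by (rule integral_spike_set; rule negligible_subset[OF negligible_sing[of "z - 1"]]; auto)
    finally show ?thesis by simp
  qed auto
  have "((\<lambda>y. integral {z - 1..y} std_normal_density) has_real_derivative std_normal_density z)
      (at z within {z - 1..z + 1})"
    by (rule integral_has_real_derivative[OF cont]) auto
  then have "((\<lambda>y. integral {z - 1..y} std_normal_density) has_real_derivative std_normal_density z) (at z)"
    by (subst (asm) at_within_interior) auto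
  then have "((\<lambda>y. std_normal_cdf (z - 1) + integral {z - 1..y} std_normal_density)
      has_real_derivative 0 + std_normal_density z) (at z)"
    by (intro DERIV_add DERIV_const)
  then have "(std_normal_cdf has_real_derivative 0 + std_normal_density z) (at z)"
    by (rule has_field_derivative_transform_within_open[of _ _ _ "{z - 1<..}"])
       (auto intro!: *[symmetric])
  then show ?thesis unfolding add_0_left .
qed

text \<open>The probability that a Brownian motion with drift \<open>\<mu>\<close> started at 0 exceeds \<open>x \<ge> 0\<close> before
  time \<open>t\<close> (the inverse Gaussian distribution function).\<close>
definition passage_cdf :: "real \<Rightarrow> real \<Rightarrow> real \<Rightarrow> real" where
  "passage_cdf \<mu> x t = exp (2 * \<mu> * x) * std_normal_cdf (- x / sqrt t - \<mu> * sqrt t)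
     + std_normal_cdf (- x / sqrt t + \<mu> * sqrt t)"

definition passage_density :: "real \<Rightarrow> real \<Rightarrow> real \<Rightarrow> real" where
  "passage_density \<mu> x t =
     (if 0 < t then x / t powr (3 / 2) * std_normal_density (- x / sqrt t + \<mu> * sqrt t) else 0)"

text \<open>Changing the sign of the drift costs exactly one exponential factor in \<open>x\<close>.  This is why the
  conditional law under \<open>P\<close> is a passage time law under \<open>P*\<close>.\<close>
lemma passage_cdf_uminus: "passage_cdf (- \<mu>) x t = exp (- 2 * \<mu> * x) * passage_cdf \<mu> x t"
proof -
  have e: "exp (- 2 * \<mu> * x) * (exp (2 * \<mu> * x) * y) = y" for y :: real
    by (simp add: mult.assoc[symmetric] exp_add[symmetric])
  show ?thesis
    unfolding passage_cdf_def distrib_left e by simp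
qed

lemma passage_cdf_nonneg: "0 \<le> passage_cdf \<mu> x t"
proof -
  interpret D: real_distribution std_normal_distribution by (rule real_dist_normal_dist)
  show ?thesis unfolding passage_cdf_def by (simp add: D.cdf_nonneg)
qed

text \<open>The two squares differ by \<open>4 \<mu> x\<close>.  Hence the time derivatives of both terms of \<open>passage_cdf\<close> carry
  the same normal density, and the contributions of the drift to them cancel.\<close>
lemma std_normal_density_shift:
  assumes "0 < t"
  shows "exp (2 * \<mu> * x) * std_normal_density (- x / sqrt t - \<mu> * sqrt t)
    = std_normal_density (- x / sqrt t + \<mu> * sqrt t)"
proof -
  have "(- x / sqrt t - \<mu> * sqrt t)\<^sup>2 = (- x / sqrt t + \<mu> * sqrt t)\<^sup>2 + 4 * \<mu> * x"
    using assms by (simp add: power2_eq_square field_simps)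
  then have "2 * \<mu> * x + - (- x / sqrt t - \<mu> * sqrt t)\<^sup>2 / 2 = - (- x / sqrt t + \<mu> * sqrt t)\<^sup>2 / 2"
    by (simp only: minus_divide_left[symmetric]) (simp add: add_divide_distrib del: minus_divide_left)
  then have "exp (2 * \<mu> * x) * exp (- (- x / sqrt t - \<mu> * sqrt t)\<^sup>2 / 2)
      = exp (- (- x / sqrt t + \<mu> * sqrt t)\<^sup>2 / 2)"
    unfolding exp_add[symmetric] by simp
  then show ?thesis unfolding std_normal_density_def by (simp add: algebra_simps)
qed

lemma DERIV_passage_cdf:
  assumes "0 < t"
  shows "DERIV (passage_cdf \<mu> x) t :> passage_density \<mu> x t"
proof -
  let ?u = "x / (2 * t * sqrt t)" and ?v = "\<mu> / (2 * sqrt t)"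
  have u: "((\<lambda>t. - x / sqrt t) has_real_derivative ?u) (at t)"
    using assms by (auto intro!: derivative_eq_intros simp: field_simps)
  have v: "((\<lambda>t. \<mu> * sqrt t) has_real_derivative ?v) (at t)"
    using assms by (auto intro!: derivative_eq_intros simp: field_simps)
  have d1: "((\<lambda>t. std_normal_cdf (- x / sqrt t - \<mu> * sqrt t)) has_real_derivative
      std_normal_density (- x / sqrt t - \<mu> * sqrt t) * (?u - ?v)) (at t)"
    by (rule DERIV_chain2[OF DERIV_std_normal_cdf DERIV_diff[OF u v]])
  have d2: "((\<lambda>t. std_normal_cdf (- x / sqrt t + \<mu> * sqrt t)) has_real_derivative
      std_normal_density (- x / sqrt t + \<mu> * sqrt t) * (?u + ?v)) (at t)"
    by (rule DERIV_chain2[OF DERIV_std_normal_cdf DERIV_add[OF u v]])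
  have "(passage_cdf \<mu> x has_real_derivative
     exp (2 * \<mu> * x) * (std_normal_density (- x / sqrt t - \<mu> * sqrt t) * (?u - ?v))
       + std_normal_density (- x / sqrt t + \<mu> * sqrt t) * (?u + ?v)) (at t)"
    unfolding passage_cdf_def[abs_def] by (intro DERIV_add DERIV_cmult d1 d2)
  also have "exp (2 * \<mu> * x) * (std_normal_density (- x / sqrt t - \<mu> * sqrt t) * (?u - ?v))
      = std_normal_density (- x / sqrt t + \<mu> * sqrt t) * (?u - ?v)"
    using std_normal_density_shift[OF assms, of \<mu> x] by (metis mult.assoc)
  also have "\<dots> + std_normal_density (- x / sqrt t + \<mu> * sqrt t) * (?u + ?v)
      = x / (t * sqrt t) * std_normal_density (- x / sqrt t + \<mu> * sqrt t)"
    using assms by (simp add: field_simps)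
  also have "t * sqrt t = t powr (3 / 2)"
    using assms powr_add[of t 1 "1/2"] by (simp add: powr_half_sqrt)
  finally show ?thesis using assms by (simp add: passage_density_def)
qed

lemma passage_cdf_at_0:
  assumes "0 < x"
  shows "((passage_cdf \<mu> x) \<longlongrightarrow> 0) (at_right 0)"
proof -
  interpret D: real_distribution std_normal_distribution by (rule real_dist_normal_dist)
  have "filterlim (\<lambda>t. - x / sqrt t - \<mu> * sqrt t) at_bot (at_right 0)"
       "filterlim (\<lambda>t. - x / sqrt t + \<mu> * sqrt t) at_bot (at_right 0)"
    using assms by real_asymp+
  then have "((passage_cdf \<mu> x) \<longlongrightarrow> exp (2 * \<mu> * x) * 0 + 0) (at_right 0)"
    unfolding passage_cdf_def[abs_def]
    by (intro tendsto_intros filterlim_compose[OF D.cdf_lim_at_bot])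
  then show ?thesis by simp
qed

lemma passage_cdf_at_top:
  assumes "0 < \<mu>"
  shows "((passage_cdf \<mu> x) \<longlongrightarrow> 1) at_top"
proof -
  interpret D: real_distribution std_normal_distribution by (rule real_dist_normal_dist)
  have "filterlim (\<lambda>t. - x / sqrt t - \<mu> * sqrt t) at_bot at_top"
       "filterlim (\<lambda>t. - x / sqrt t + \<mu> * sqrt t) at_top at_top"
    using assms by real_asymp+
  then have "((passage_cdf \<mu> x) \<longlongrightarrow> exp (2 * \<mu> * x) * 0 + 1) at_top"
    unfolding passage_cdf_def[abs_def]
    by (intro tendsto_intros filterlim_compose[OF D.cdf_lim_at_bot] filterlim_compose[OF D.cdf_lim_at_top_prob])
  then show ?thesis by simp
qed

lemma passage_density_nonneg: "0 \<le> x \<Longrightarrow> 0 \<le> passage_density \<mu> x t"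
  by (simp add: passage_density_def)

lemma borel_measurable_passage_density[measurable]:
  "(\<lambda>(x, t). passage_density \<mu> x t) \<in> borel_measurable (borel \<Otimes>\<^sub>M borel)"
  unfolding passage_density_def by measurable

lemma isCont_passage_density: "0 < t \<Longrightarrow> isCont (passage_density \<mu> x) t"
proof -
  assume t: "0 < t"
  have "isCont (\<lambda>t. x / t powr (3 / 2) * std_normal_density (- x / sqrt t + \<mu> * sqrt t)) t"
    unfolding std_normal_density_def using t by (intro continuous_intros) auto
  moreover have "\<forall>\<^sub>F s in nhds t. x / s powr (3 / 2) * std_normal_density (- x / sqrt s + \<mu> * sqrt s)
      = passage_density \<mu> x s"
    using eventually_nhds_in_open[of "{0<..}" t] t by (auto simp: passage_density_def elim: eventually_mono)
  ultimately show ?thesis by (simp only: isCont_cong)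
qed

text \<open>One statement for finite and infinite \<open>b\<close>, so that it gives both the distribution function and the
  total mass; \<open>B\<close> is the limit of \<open>passage_cdf\<close> at \<open>b\<close>.\<close>
lemma nn_integral_passage_density_FTC:
  assumes "0 < x" "0 < b" "((passage_cdf \<mu> x \<circ> real_of_ereal) \<longlongrightarrow> B) (at_left b)"
  shows "(\<integral>\<^sup>+t. ennreal (passage_density \<mu> x t) * indicator (einterval 0 b) t \<partial>lborel) = ennreal B"
proof -
  note FTC = interval_integral_FTC_nonneg[of "0::ereal" b "passage_cdf \<mu> x" "passage_density \<mu> x" 0 B]
  have A: "((passage_cdf \<mu> x \<circ> real_of_ereal) \<longlongrightarrow> 0) (at_right 0)"
    using passage_cdf_at_0[OF assms(1), of \<mu>] unfolding zero_ereal_def ereal_tendsto_simps .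
  have 1: "set_integrable lborel (einterval 0 b) (passage_density \<mu> x)"
      and 2: "(LBINT t=0..b. passage_density \<mu> x t) = B - 0"
    using assms A
    by (intro FTC; auto simp: zero_ereal_def intro!: DERIV_passage_cdf isCont_passage_density passage_density_nonneg)+
  have "(\<integral>\<^sup>+t. ennreal (passage_density \<mu> x t) * indicator (einterval 0 b) t \<partial>lborel)
      = (\<integral>\<^sup>+t. ennreal (indicator (einterval 0 b) t *\<^sub>R passage_density \<mu> x t) \<partial>lborel)"
    by (intro nn_integral_cong) (auto split: split_indicator)
  also have "\<dots> = ennreal (set_lebesgue_integral lborel (einterval 0 b) (passage_density \<mu> x))"
    unfolding set_lebesgue_integral_def
    using 1 assms(1) by (intro nn_integral_eq_integral) (auto simp: set_integrable_def passage_density_nonneg split: split_indicator)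
  also have "set_lebesgue_integral lborel (einterval 0 b) (passage_density \<mu> x) = B"
    using 2 assms(2) less_imp_le[OF assms(2)] by (simp add: interval_lebesgue_integral_def)
  finally show ?thesis .
qed

lemma nn_integral_passage_density:
  assumes "0 < x" "0 < t"
  shows "(\<integral>\<^sup>+s. ennreal (passage_density \<mu> x s) * indicator {..t} s \<partial>lborel) = ennreal (passage_cdf \<mu> x t)"
proof -
  have "(passage_cdf \<mu> x \<longlongrightarrow> passage_cdf \<mu> x t) (at_left t)"
    using DERIV_isCont[OF DERIV_passage_cdf[OF assms(2), of \<mu> x]]
    by (meson continuous_at_split continuous_within)
  then have "((passage_cdf \<mu> x \<circ> real_of_ereal) \<longlongrightarrow> passage_cdf \<mu> x t) (at_left (ereal t))"
    unfolding ereal_tendsto_simps .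
  from nn_integral_passage_density_FTC[OF assms(1) _ this] assms(2)
  have "(\<integral>\<^sup>+s. ennreal (passage_density \<mu> x s) * indicator (einterval 0 (ereal t)) s \<partial>lborel)
      = ennreal (passage_cdf \<mu> x t)" by simp
  also have "(\<integral>\<^sup>+s. ennreal (passage_density \<mu> x s) * indicator (einterval 0 (ereal t)) s \<partial>lborel)
     = (\<integral>\<^sup>+s. ennreal (passage_density \<mu> x s) * indicator {..t} s \<partial>lborel)"
  proof (rule nn_integral_cong_AE)
    show "AE s in lborel. ennreal (passage_density \<mu> x s) * indicator (einterval 0 (ereal t)) s
        = ennreal (passage_density \<mu> x s) * indicator {..t} s"
      using AE_lborel_singleton[of t]
      by eventually_elim (auto simp: einterval_def passage_density_def zero_ereal_def split: split_indicator)
  qed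
  finally show ?thesis .
qed

text \<open>Positive drift carries the path over every level; with negative drift the mass would only be
  \<open>exp (2 \<mu> x)\<close>.\<close>
lemma nn_integral_passage_density_total:
  assumes "0 < x" "0 < \<mu>"
  shows "(\<integral>\<^sup>+s. ennreal (passage_density \<mu> x s) \<partial>lborel) = 1"
proof -
  have "((passage_cdf \<mu> x \<circ> real_of_ereal) \<longlongrightarrow> 1) (at_left \<infinity>)"
    using passage_cdf_at_top[OF assms(2), of x] unfolding ereal_tendsto_simps .
  from nn_integral_passage_density_FTC[OF assms(1) _ this]
  have "(\<integral>\<^sup>+s. ennreal (passage_density \<mu> x s) * indicator (einterval 0 \<infinity>) s \<partial>lborel) = 1" by simp
  also have "(\<integral>\<^sup>+s. ennreal (passage_density \<mu> x s) * indicator (einterval 0 \<infinity>) s \<partial>lborel)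
     = (\<integral>\<^sup>+s. ennreal (passage_density \<mu> x s) \<partial>lborel)"
    by (intro nn_integral_cong) (auto simp: einterval_def passage_density_def zero_ereal_def split: split_indicator)
  finally show ?thesis .
qed

section \<open>Dyadic approximation of continuous paths\<close>

text \<open>A continuous function exceeds \<open>x\<close> on a neighbourhood, and a sufficiently fine grid meets it.\<close>

lemma eventually_grid_exceeds:
  fixes f :: "real \<Rightarrow> real"
  assumes cont: "continuous_on {0..b} f" and s: "s \<in> {0..b}" and x: "x < f s"
  shows "\<forall>\<^sub>F N in sequentially. \<exists>k\<le>2 ^ N. x < f (b / 2 ^ N * real k)"
proof (cases "b = 0")
  case True
  then show ?thesis using s x by (auto intro!: always_eventually exI[of _ 0])
next
  case False
  then have b: "0 < b" using s by auto
  have "\<exists>d>0. \<forall>r\<in>{0..b}. dist r s < d \<longrightarrow> dist (f r) (f s) < f s - x"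
    using cont s x unfolding continuous_on_iff by auto
  then obtain d where d: "0 < d" "\<And>r. r \<in> {0..b} \<Longrightarrow> \<bar>r - s\<bar> < d \<Longrightarrow> \<bar>f r - f s\<bar> < f s - x"
    by (auto simp: dist_real_def)
  have "(\<lambda>N. b / 2 ^ N) \<longlonglongrightarrow> 0" by real_asymp
  then have "\<forall>\<^sub>F N in sequentially. b / 2 ^ N < d"
    using d(1) by (rule order_tendstoD(2))
  then show ?thesis
  proof eventually_elim
    case (elim N)
    define k where "k = nat \<lfloor>s / (b / 2 ^ N)\<rfloor>"
    have h: "0 < b / 2 ^ N" using b by simp
    have q: "0 \<le> s / (b / 2 ^ N)" "s / (b / 2 ^ N) \<le> 2 ^ N"
      using s b by (auto simp: field_simps)
    have k: "real k \<le> s / (b / 2 ^ N)" "s / (b / 2 ^ N) < real k + 1"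
      using q(1) unfolding k_def by linarith+
    have "real k \<le> 2 ^ N" using k(1) q(2) by linarith
    then have k2: "k \<le> 2 ^ N" by (metis of_nat_le_iff of_nat_numeral of_nat_power)
    have le: "b / 2 ^ N * real k \<le> s" "s < b / 2 ^ N * real k + b / 2 ^ N"
      using k unfolding pos_le_divide_eq[OF h] pos_less_divide_eq[OF h] pos_divide_less_eq[OF h]
      by (simp_all add: algebra_simps add_divide_distrib)
    have "\<bar>f (b / 2 ^ N * real k) - f s\<bar> < f s - x"
      using le h s elim by (intro d(2)) auto
    then show ?case using k2 by (intro exI[of _ k]) auto
  qed
qed

text \<open>The overshoot over the level at the first grid point above it vanishes in the limit: the preceding
  grid point is still at or below \<open>x\<close>, and uniform continuity bounds the step between the two.\<close>
lemma LEAST_grid_exceeds_tendsto: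
  fixes f :: "real \<Rightarrow> real"
  assumes cont: "continuous_on {0..b} f" and s: "s \<in> {0..b}" and x: "x < f s" "f 0 \<le> x"
  shows "(\<lambda>N. f (b / 2 ^ N * real (LEAST k. x < f (b / 2 ^ N * real k)))) \<longlonglongrightarrow> x"
proof (rule LIMSEQ_I)
  fix e :: real assume e: "0 < e"
  have b: "0 < b" using s x by (cases "b = 0") auto
  have "uniformly_continuous_on {0..b} f"
    using cont by (intro compact_uniformly_continuous) auto
  then obtain d where d: "0 < d" "\<And>r s. r \<in> {0..b} \<Longrightarrow> s \<in> {0..b} \<Longrightarrow> \<bar>r - s\<bar> < d \<Longrightarrow> \<bar>f r - f s\<bar> < e"
    unfolding uniformly_continuous_on_def using e by (metis dist_real_def)
  have "(\<lambda>N. b / 2 ^ N) \<longlonglongrightarrow> 0" by real_asymp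
  then have "\<forall>\<^sub>F N in sequentially. b / 2 ^ N < d"
    using d(1) by (rule order_tendstoD(2))
  with eventually_grid_exceeds[OF cont s x(1)]
  have "\<forall>\<^sub>F N in sequentially. norm (f (b / 2 ^ N * real (LEAST k. x < f (b / 2 ^ N * real k))) - x) < e"
  proof eventually_elim
    case (elim N)
    define k where "k = (LEAST k. x < f (b / 2 ^ N * real k))"
    obtain k' where k': "k' \<le> 2 ^ N" "x < f (b / 2 ^ N * real k')" using elim by auto
    have kx: "x < f (b / 2 ^ N * real k)" and "k \<le> k'"
      unfolding k_def using k'(2) by (auto intro: LeastI Least_le)
    then have k2: "k \<le> 2 ^ N" using k' by simp
    have "k \<noteq> 0" using kx x(2) by (cases k) auto
    then obtain j where j: "k = Suc j" by (cases k) auto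
    have jx: "f (b / 2 ^ N * real j) \<le> x"
      using not_less_Least[of j "\<lambda>k. x < f (b / 2 ^ N * real k)"] j unfolding k_def[symmetric] by auto
    have *: "b / 2 ^ N * real i \<in> {0..b}" if "i \<le> 2 ^ N" for i
    proof -
      have "real i \<le> 2 ^ N" using that by (metis of_nat_le_iff of_nat_numeral of_nat_power)
      then show ?thesis using b by (simp add: field_simps)
    qed
    have "\<bar>b / 2 ^ N * real k - b / 2 ^ N * real j\<bar> < d"
      using elim b by (simp add: j algebra_simps add_divide_distrib)
    then have "\<bar>f (b / 2 ^ N * real k) - f (b / 2 ^ N * real j)\<bar> < e"
      using k2 j by (intro d(2) *) auto
    then show ?case unfolding k_def[symmetric] using kx jx by auto
  qed
  then show "\<exists>N0. \<forall>N\<ge>N0. norm (f (b / 2 ^ N * real (LEAST k. x < f (b / 2 ^ N * real k))) - x) < e"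
    by (simp add: eventually_sequentially)
qed

text \<open>Decomposing an event according to the first index at which it happens: at most one summand is
  nonzero.\<close>
lemma sum_first_index:
  fixes a :: "nat \<Rightarrow> 'b::comm_monoid_add"
  shows "(\<Sum>k\<le>n. if Q k \<and> (\<forall>j<k. \<not> Q j) then a k else 0)
    = (if \<exists>k\<le>n. Q k then a (LEAST k. Q k) else 0)"
proof (cases "\<exists>k\<le>n. Q k")
  case True
  then obtain k' where k': "k' \<le> n" "Q k'" by auto
  define m where "m = (LEAST k. Q k)"
  have m: "Q m" "m \<le> n"
    unfolding m_def using k' by (auto intro: LeastI order.trans[OF Least_le])
  have "(Q k \<and> (\<forall>j<k. \<not> Q j)) = (k = m)" for k
    using m(1) not_less_Least[of _ Q] unfolding m_def[symmetric]
    by (metis linorder_neqE_nat)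
  then show ?thesis using True m(2) by (simp add: m_def[symmetric])
qed (auto intro!: sum.neutral)

section \<open>Brownian increments and independence on a grid\<close>

text \<open>Fubini for independent variables, with independence expressed by the product form of the joint law,
  so that the two variables may have values of different types.\<close>

lemma (in prob_space) nn_integral_product_distr:
  assumes [measurable]: "X \<in> M \<rightarrow>\<^sub>M S" "Y \<in> M \<rightarrow>\<^sub>M T"
    and prod: "distr M S X \<Otimes>\<^sub>M distr M T Y = distr M (S \<Otimes>\<^sub>M T) (\<lambda>\<omega>. (X \<omega>, Y \<omega>))"
    and F[measurable]: "F \<in> borel_measurable (S \<Otimes>\<^sub>M T)"
  shows "(\<integral>\<^sup>+\<omega>. F (X \<omega>, Y \<omega>) \<partial>M) = (\<integral>\<^sup>+\<omega>. (\<integral>\<^sup>+\<omega>'. F (X \<omega>, Y \<omega>') \<partial>M) \<partial>M)"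
proof -
  interpret Y: prob_space "distr M T Y" by (rule prob_space_distr) measurable
  have "(\<integral>\<^sup>+\<omega>. F (X \<omega>, Y \<omega>) \<partial>M) = (\<integral>\<^sup>+z. F z \<partial>(distr M S X \<Otimes>\<^sub>M distr M T Y))"
    unfolding prod by (subst nn_integral_distr) auto
  also have "\<dots> = (\<integral>\<^sup>+x. \<integral>\<^sup>+y. F (x, y) \<partial>distr M T Y \<partial>distr M S X)"
    by (rule Y.nn_integral_fst[symmetric]) simp
  also have "\<dots> = (\<integral>\<^sup>+\<omega>. \<integral>\<^sup>+y. F (X \<omega>, y) \<partial>distr M T Y \<partial>M)"
    by (rule nn_integral_distr) auto
  also have "\<dots> = (\<integral>\<^sup>+\<omega>. (\<integral>\<^sup>+\<omega>'. F (X \<omega>, Y \<omega>') \<partial>M) \<partial>M)"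
    by (intro nn_integral_cong nn_integral_distr) auto
  finally show ?thesis .
qed

text \<open>In \<open>brownian_motion\<close> the start is 0 only almost surely.  Subtracting \<open>W 0\<close>, or \<open>W t\<close> for the
  process restarted at \<open>t\<close>, gives a start that is 0 for every outcome, which removes exceptional sets
  from all pathwise arguments.\<close>
locale centred_brownian_motion = brownian_motion +
  assumes centred: "W 0 \<omega> = 0"

lemma (in brownian_motion) centred_increments:
  assumes "0 \<le> t"
  shows "centred_brownian_motion P (\<lambda>s \<omega>. W (t + s) \<omega> - W t \<omega>) \<mu>"
proof unfold_locales
  fix s :: real assume "0 \<le> s"
  then show "(\<lambda>\<omega>. W (t + s) \<omega> - W t \<omega>) \<in> borel_measurable P"
    using assms by (intro borel_measurable_diff measurable_W) auto
next
  fix \<omega> assume "\<omega> \<in> space P"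
  from continuous_paths[OF this] assms
  have "continuous_on {0..} (\<lambda>s. W (t + s) \<omega>)"
    by (intro continuous_on_compose2[where g = "\<lambda>s. W s \<omega>" and f = "\<lambda>s. t + s"])
       (auto intro!: continuous_intros)
  then show "continuous_on {0..} (\<lambda>s. W (t + s) \<omega> - W t \<omega>)"
    by (intro continuous_intros)
next
  fix s r :: real assume "0 \<le> s" "s < r"
  then show "distributed P lborel (\<lambda>\<omega>. W (t + r) \<omega> - W t \<omega> - (W (t + s) \<omega> - W t \<omega>))
      (\<lambda>x. ennreal (normal_density (\<mu> * (r - s)) (sqrt (r - s)) x))"
    using normal_increments[of "t + s" "t + r"] assms by simp
next
  fix n :: nat and ts :: "nat \<Rightarrow> real" assume ts: "0 \<le> ts 0" "strict_mono ts"
  have "strict_mono (\<lambda>i. t + ts i)" using ts(2) by (auto simp: strict_mono_def)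
  from indep_increments[OF _ this, of n] ts(1) assms
  show "indep_vars (\<lambda>_. borel) (\<lambda>i \<omega>. W (t + ts (Suc i)) \<omega> - W t \<omega> - (W (t + ts i) \<omega> - W t \<omega>)) {..<n}"
    by simp
qed auto

context centred_brownian_motion
begin

lemma normal_W: "0 < t \<Longrightarrow> distributed P lborel (W t) (normal_density (\<mu> * t) (sqrt t))"
  using normal_increments[of 0 t] by (simp add: centred)

lemma continuous_W: "\<omega> \<in> space P \<Longrightarrow> 0 \<le> t \<Longrightarrow> continuous_on {0..t} (\<lambda>s. W s \<omega>)"
  by (rule continuous_on_subset[OF continuous_paths]) auto

text \<open>Both blocks of values are partial sums over disjoint sets of increments.\<close>
lemma indep_grid_past_future:
  assumes h: "0 < h"
  shows "indep_var (PiM {..k} (\<lambda>_. borel)) (\<lambda>\<omega>. \<lambda>j\<in>{..k}. W (h * real j) \<omega>)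
    (PiM {..m} (\<lambda>_. borel)) (\<lambda>\<omega>. \<lambda>j\<in>{..m}. W (h * real (k + j)) \<omega> - W (h * real k) \<omega>)"
proof -
  define X where "X i \<omega> = W (h * real (Suc i)) \<omega> - W (h * real i) \<omega>" for i \<omega>
  have "strict_mono (\<lambda>i. h * real i)" using h by (auto simp: strict_mono_def)
  from indep_increments[OF _ this, of "k + m"]
  have "indep_vars (\<lambda>_. borel) X {..<k + m}" by (simp add: X_def[abs_def])
  then have ind: "indep_var (PiM {..<k} (\<lambda>_. borel)) (\<lambda>\<omega>. \<lambda>i\<in>{..<k}. X i \<omega>)
      (PiM {k..<k + m} (\<lambda>_. borel)) (\<lambda>\<omega>. \<lambda>i\<in>{k..<k + m}. X i \<omega>)"
    by (rule indep_var_restrict) auto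
  let ?A = "\<lambda>x::nat \<Rightarrow> real. \<lambda>j\<in>{..k}. \<Sum>i\<in>{0..<j}. x i"
  let ?B = "\<lambda>x::nat \<Rightarrow> real. \<lambda>j\<in>{..m}. \<Sum>i\<in>{k..<k + j}. x i"
  have A: "?A \<in> PiM {..<k} (\<lambda>_. borel) \<rightarrow>\<^sub>M PiM {..k} (\<lambda>_. borel)"
    by (intro measurable_restrict borel_measurable_sum measurable_component_singleton) auto
  have B: "?B \<in> PiM {k..<k + m} (\<lambda>_. borel) \<rightarrow>\<^sub>M PiM {..m} (\<lambda>_. borel)"
    by (intro measurable_restrict borel_measurable_sum measurable_component_singleton) auto
  have tel: "(\<Sum>i\<in>{a..<a + j}. X i \<omega>) = W (h * real (a + j)) \<omega> - W (h * real a) \<omega>" for a j \<omega>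
    by (induction j) (simp_all add: X_def)
  have "?A \<circ> (\<lambda>\<omega>. \<lambda>i\<in>{..<k}. X i \<omega>) = (\<lambda>\<omega>. \<lambda>j\<in>{..k}. W (h * real j) \<omega>)"
  proof (intro ext)
    fix \<omega> j
    have "(\<Sum>i\<in>{0..<j}. (\<lambda>i\<in>{..<k}. X i \<omega>) i) = W (h * real j) \<omega>" if "j \<le> k"
    proof -
      have "(\<Sum>i\<in>{0..<j}. (\<lambda>i\<in>{..<k}. X i \<omega>) i) = (\<Sum>i\<in>{0..<0 + j}. X i \<omega>)"
        using that by (intro sum.cong) auto
      then show ?thesis unfolding tel by (simp add: centred)
    qed
    then show "(?A \<circ> (\<lambda>\<omega>. \<lambda>i\<in>{..<k}. X i \<omega>)) \<omega> j = (\<lambda>j\<in>{..k}. W (h * real j) \<omega>) j"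
      by (simp add: restrict_def)
  qed
  moreover have "?B \<circ> (\<lambda>\<omega>. \<lambda>i\<in>{k..<k + m}. X i \<omega>)
      = (\<lambda>\<omega>. \<lambda>j\<in>{..m}. W (h * real (k + j)) \<omega> - W (h * real k) \<omega>)"
  proof (intro ext)
    fix \<omega> j
    have "(\<Sum>i\<in>{k..<k + j}. (\<lambda>i\<in>{k..<k + m}. X i \<omega>) i) = W (h * real (k + j)) \<omega> - W (h * real k) \<omega>"
      if "j \<le> m"
    proof -
      have "(\<Sum>i\<in>{k..<k + j}. (\<lambda>i\<in>{k..<k + m}. X i \<omega>) i) = (\<Sum>i\<in>{k..<k + j}. X i \<omega>)"
        using that by (intro sum.cong) auto
      then show ?thesis unfolding tel .
    qed
    then show "(?B \<circ> (\<lambda>\<omega>. \<lambda>i\<in>{k..<k + m}. X i \<omega>)) \<omega> j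
        = (\<lambda>j\<in>{..m}. W (h * real (k + j)) \<omega> - W (h * real k) \<omega>) j"
      by (simp add: restrict_def)
  qed
  ultimately show ?thesis using indep_var_compose[OF ind A B] by simp
qed

section \<open>The reflection principle with drift\<close>

text \<open>The law of \<open>- D\<close> has density \<open>exp (- 2 \<mu> y)\<close> with respect to the law of \<open>D\<close>, when \<open>D\<close> is normal
  with mean \<open>\<mu> (t - s)\<close> and variance \<open>t - s\<close>; the length of the interval drops out.\<close>

lemma nn_integral_reflect_increment:
  assumes "0 \<le> s" "s \<le> t" and f[measurable]: "f \<in> borel_measurable borel"
  shows "(\<integral>\<^sup>+\<omega>. f (W t \<omega> - W s \<omega>) \<partial>P)
    = (\<integral>\<^sup>+\<omega>. f (- (W t \<omega> - W s \<omega>)) * ennreal (exp (- 2 * \<mu> * (W t \<omega> - W s \<omega>))) \<partial>P)"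
proof (cases "s = t")
  case False
  then have st: "s < t" using assms by simp
  let ?n = "\<lambda>y. normal_density (\<mu> * (t - s)) (sqrt (t - s)) y"
  note D = normal_increments[OF assms(1) st]
  have refl: "?n (- y) = ?n y * exp (- 2 * \<mu> * y)" for y
  proof -
    have "- (- y - \<mu> * (t - s))\<^sup>2 / (2 * (t - s)) = - (y - \<mu> * (t - s))\<^sup>2 / (2 * (t - s)) + - 2 * \<mu> * y"
      using st by (simp add: field_simps) (simp add: power2_eq_square algebra_simps)
    then have "exp (- (- y - \<mu> * (t - s))\<^sup>2 / (2 * (t - s)))
        = exp (- (y - \<mu> * (t - s))\<^sup>2 / (2 * (t - s))) * exp (- 2 * \<mu> * y)"
      by (simp only: exp_add)
    then show ?thesis using st unfolding normal_density_def by simp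
  qed
  have "(\<integral>\<^sup>+\<omega>. f (W t \<omega> - W s \<omega>) \<partial>P) = (\<integral>\<^sup>+y. ennreal (?n y) * f y \<partial>lborel)"
    by (rule distributed_nn_integral[OF D, symmetric]) simp
  also have "\<dots> = ennreal \<bar>- 1\<bar> * (\<integral>\<^sup>+y. ennreal (?n (0 + (- 1) * y)) * f (0 + (- 1) * y) \<partial>lborel)"
    by (rule nn_integral_real_affine) auto
  also have "\<dots> = (\<integral>\<^sup>+y. ennreal (?n (- y)) * f (- y) \<partial>lborel)"
    by simp
  also have "\<dots> = (\<integral>\<^sup>+y. ennreal (?n y) * (f (- y) * ennreal (exp (- 2 * \<mu> * y))) \<partial>lborel)"
    unfolding refl by (intro nn_integral_cong) (simp add: ennreal_mult' ac_simps)
  also have "\<dots> = (\<integral>\<^sup>+\<omega>. f (- (W t \<omega> - W s \<omega>)) * ennreal (exp (- 2 * \<mu> * (W t \<omega> - W s \<omega>))) \<partial>P)"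
    by (rule distributed_nn_integral[OF D]) simp
  finally show ?thesis .
qed simp

text \<open>Conditionally on the path up to the \<open>k\<close>-th grid point, reflect what follows.\<close>
lemma nn_integral_reflect_future:
  assumes h: "0 < h" and k: "k \<le> n"
    and F[measurable]: "F \<in> borel_measurable (PiM {..k} (\<lambda>_. borel) \<Otimes>\<^sub>M borel)"
  defines "S \<equiv> \<lambda>\<omega>. \<lambda>j\<in>{..k}. W (h * real j) \<omega>"
    and "D \<equiv> \<lambda>\<omega>. W (h * real n) \<omega> - W (h * real k) \<omega>"
  shows "(\<integral>\<^sup>+\<omega>. F (S \<omega>, D \<omega>) \<partial>P) = (\<integral>\<^sup>+\<omega>. F (S \<omega>, - D \<omega>) * ennreal (exp (- 2 * \<mu> * D \<omega>)) \<partial>P)"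
proof -
  let ?Pi = "\<lambda>k. PiM {..k::nat} (\<lambda>_. borel :: real measure)"
  define Y where "Y = (\<lambda>\<omega>. \<lambda>j\<in>{..n - k}. W (h * real (k + j)) \<omega> - W (h * real k) \<omega>)"
  have D: "Y \<omega> (n - k) = D \<omega>" for \<omega>
    using k by (simp add: Y_def D_def)
  have ind: "indep_var (?Pi k) S (?Pi (n - k)) Y"
    unfolding S_def Y_def by (rule indep_grid_past_future[OF h])
  note S[measurable] = indep_var_rv1[OF ind] and Y[measurable] = indep_var_rv2[OF ind]
  note Fubini = nn_integral_product_distr[OF S Y indep_var_distribution_eq[THEN iffD1, OF ind, THEN conjunct2, THEN conjunct2]]
  have [measurable]: "(\<lambda>z. snd z (n - k)) \<in> borel_measurable (?Pi k \<Otimes>\<^sub>M ?Pi (n - k))"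
    by (intro measurable_compose[OF measurable_snd measurable_component_singleton]) auto
  have "(\<integral>\<^sup>+\<omega>. F (S \<omega>, D \<omega>) \<partial>P) = (\<integral>\<^sup>+\<omega>. (\<integral>\<^sup>+\<omega>'. F (S \<omega>, D \<omega>') \<partial>P) \<partial>P)"
    using Fubini[of "\<lambda>z. F (fst z, snd z (n - k))"] by (simp add: D)
  also have "\<dots> = (\<integral>\<^sup>+\<omega>. (\<integral>\<^sup>+\<omega>'. F (S \<omega>, - D \<omega>') * ennreal (exp (- 2 * \<mu> * D \<omega>')) \<partial>P) \<partial>P)"
  proof (rule nn_integral_cong)
    fix \<omega> assume "\<omega> \<in> space P"
    then have "S \<omega> \<in> space (?Pi k)"
      by (rule measurable_space[OF S])
    then have "(\<lambda>d. F (S \<omega>, d)) \<in> borel_measurable borel" by measurable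
    then show "(\<integral>\<^sup>+\<omega>'. F (S \<omega>, D \<omega>') \<partial>P)
        = (\<integral>\<^sup>+\<omega>'. F (S \<omega>, - D \<omega>') * ennreal (exp (- 2 * \<mu> * D \<omega>')) \<partial>P)"
      unfolding D_def using h k by (intro nn_integral_reflect_increment) auto
  qed
  also have "\<dots> = (\<integral>\<^sup>+\<omega>. F (S \<omega>, - D \<omega>) * ennreal (exp (- 2 * \<mu> * D \<omega>)) \<partial>P)"
    using Fubini[of "\<lambda>z. F (fst z, - snd z (n - k)) * ennreal (exp (- 2 * \<mu> * snd z (n - k)))"]
    by (simp add: D)
  finally show ?thesis .
qed

text \<open>The path is reflected after the first grid point \<open>\<kappa>\<close> above the level, so its end point \<open>S n\<close>
  becomes \<open>2 S \<kappa> - S n\<close>.  The random index is dealt with by splitting according to its value: that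
  \<open>\<kappa> = k\<close> is decided by the path up to the \<open>k\<close>-th grid point.\<close>
lemma grid_reflection:
  fixes x :: real and n :: nat
  assumes h: "0 < h" and G[measurable]: "G \<in> borel_measurable borel"
  defines "S \<equiv> \<lambda>k \<omega>. W (h * real k) \<omega>"
    and "\<kappa> \<equiv> \<lambda>\<omega>. LEAST k. x < W (h * real k) \<omega>"
  shows "(\<integral>\<^sup>+\<omega>. (if \<exists>k\<le>n. x < S k \<omega> then G (S n \<omega>) else 0) \<partial>P)
    = (\<integral>\<^sup>+\<omega>. (if \<exists>k\<le>n. x < S k \<omega>
        then G (2 * S (\<kappa> \<omega>) \<omega> - S n \<omega>) * ennreal (exp (- 2 * \<mu> * (S n \<omega> - S (\<kappa> \<omega>) \<omega>))) else 0) \<partial>P)"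
    (is "?L = ?R")
proof -
  define C where "C k \<omega> \<longleftrightarrow> x < S k \<omega> \<and> (\<forall>j<k. \<not> x < S j \<omega>)" for k \<omega>
  have S[measurable]: "S k \<in> borel_measurable P" for k
    unfolding S_def using h by (intro measurable_W) auto
  have [measurable]: "Measurable.pred P (C k)" for k unfolding C_def by measurable
  have "?L = (\<integral>\<^sup>+\<omega>. (\<Sum>k\<le>n. if C k \<omega> then G (S n \<omega>) else 0) \<partial>P)"
    unfolding C_def sum_first_index ..
  also have "\<dots> = (\<Sum>k\<le>n. \<integral>\<^sup>+\<omega>. (if C k \<omega> then G (S n \<omega>) else 0) \<partial>P)"
    by (rule nn_integral_sum) measurable
  also have "\<dots> = (\<Sum>k\<le>n. \<integral>\<^sup>+\<omega>. (if C k \<omega>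
      then G (2 * S k \<omega> - S n \<omega>) * ennreal (exp (- 2 * \<mu> * (S n \<omega> - S k \<omega>))) else 0) \<partial>P)"
  proof (rule sum.cong)
    fix k assume "k \<in> {..n}"
    then have k: "k \<le> n" by simp
    define F :: "(nat \<Rightarrow> real) \<times> real \<Rightarrow> ennreal" where
      "F = (\<lambda>(p, d). if x < p k \<and> (\<forall>j\<in>{..<k}. \<not> x < p j) then G (p k + d) else 0)"
    have pr[measurable]: "(\<lambda>z. fst z j) \<in> borel_measurable (PiM {..k} (\<lambda>_. borel) \<Otimes>\<^sub>M (borel::real measure))"
      if "j \<le> k" for j
      using that by (intro measurable_compose[OF measurable_fst measurable_component_singleton]) auto
    have F: "F \<in> borel_measurable (PiM {..k} (\<lambda>_. borel) \<Otimes>\<^sub>M borel)"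
      unfolding F_def split_beta'
      by (intro measurable_If measurable_compose[OF borel_measurable_add[OF pr] G] measurable_snd
            pred_intros_logic pred_intros_finite(3) borel_measurable_pred_less measurable_const pr) auto
    have C': "(x < (\<lambda>j\<in>{..k}. W (h * real j) \<omega>) k \<and>
        (\<forall>i\<in>{..<k}. \<not> x < (\<lambda>j\<in>{..k}. W (h * real j) \<omega>) i)) = C k \<omega>" for \<omega>
      by (auto simp: C_def S_def)
    have "(\<integral>\<^sup>+\<omega>. (if C k \<omega> then G (S n \<omega>) else 0) \<partial>P)
        = (\<integral>\<^sup>+\<omega>. F (\<lambda>j\<in>{..k}. W (h * real j) \<omega>, W (h * real n) \<omega> - W (h * real k) \<omega>) \<partial>P)"
      unfolding F_def split C' by (intro nn_integral_cong) (simp add: S_def)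
    also have "\<dots> = (\<integral>\<^sup>+\<omega>. F (\<lambda>j\<in>{..k}. W (h * real j) \<omega>, - (W (h * real n) \<omega> - W (h * real k) \<omega>))
        * ennreal (exp (- 2 * \<mu> * (W (h * real n) \<omega> - W (h * real k) \<omega>))) \<partial>P)"
      by (rule nn_integral_reflect_future[OF h k F])
    also have "\<dots> = (\<integral>\<^sup>+\<omega>. (if C k \<omega>
      then G (2 * S k \<omega> - S n \<omega>) * ennreal (exp (- 2 * \<mu> * (S n \<omega> - S k \<omega>))) else 0) \<partial>P)"
      unfolding F_def split C' by (intro nn_integral_cong) (simp add: S_def)
    finally show "(\<integral>\<^sup>+\<omega>. (if C k \<omega> then G (S n \<omega>) else 0) \<partial>P) = \<dots>" .
  qed simp
  also have "\<dots> = (\<integral>\<^sup>+\<omega>. (\<Sum>k\<le>n. if C k \<omega>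
      then G (2 * S k \<omega> - S n \<omega>) * ennreal (exp (- 2 * \<mu> * (S n \<omega> - S k \<omega>))) else 0) \<partial>P)"
    by (rule nn_integral_sum[symmetric]) measurable
  also have "\<dots> = ?R"
    unfolding C_def sum_first_index \<kappa>_def S_def ..
  finally show ?thesis .
qed

end

section \<open>The law of the running maximum\<close>

lemma exceeds_iff_grid_exceeds:
  fixes f :: "real \<Rightarrow> real"
  assumes "continuous_on {0..b} f" and "0 \<le> b"
  shows "(\<exists>s\<in>{0..b}. x < f s) \<longleftrightarrow> (\<exists>N. \<exists>k\<le>2 ^ N. x < f (b / 2 ^ N * real k))"
proof
  assume "\<exists>s\<in>{0..b}. x < f s"
  then show "\<exists>N. \<exists>k\<le>2 ^ N. x < f (b / 2 ^ N * real k)"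
    using eventually_happens[OF eventually_grid_exceeds[OF assms(1)]] by auto
next
  assume "\<exists>N. \<exists>k\<le>2 ^ N. x < f (b / 2 ^ N * real k)"
  then obtain N k where k: "k \<le> (2::nat) ^ N" "x < f (b / 2 ^ N * real k)" by auto
  have "real k \<le> 2 ^ N" using k(1) by (metis of_nat_le_iff of_nat_numeral of_nat_power)
  then have "b * real k \<le> b * 2 ^ N" using assms(2) by (rule mult_left_mono)
  then have "b / 2 ^ N * real k \<in> {0..b}" using assms(2) by (simp add: field_simps)
  then show "\<exists>s\<in>{0..b}. x < f s" using k(2) by auto
qed

text \<open>An uncountable union over times becomes a countable one by continuity.  The level may be random,
  which allows comparison with the running maximum itself.\<close>
lemma (in brownian_motion) pred_exceeds[measurable]:
  assumes "0 \<le> t" and [measurable]: "X \<in> borel_measurable P"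
  shows "Measurable.pred P (\<lambda>\<omega>. \<exists>s\<in>{0..t}. X \<omega> < W s \<omega>)"
proof -
  have [measurable]: "(\<lambda>\<omega>. W (t / 2 ^ N * real k) \<omega>) \<in> borel_measurable P" for N k
    using assms by (intro measurable_W) auto
  have "Measurable.pred P (\<lambda>\<omega>. \<exists>N. \<exists>k\<in>{..2 ^ N}. X \<omega> < W (t / 2 ^ N * real k) \<omega>)"
    by measurable
  also have "?this \<longleftrightarrow> ?thesis"
  proof (rule measurable_cong)
    fix \<omega> assume "\<omega> \<in> space P"
    then have "continuous_on {0..t} (\<lambda>s. W s \<omega>)"
      by (intro continuous_on_subset[OF continuous_paths]) auto
    from exceeds_iff_grid_exceeds[OF this assms(1), of "X \<omega>"]
    show "(\<exists>N. \<exists>k\<in>{..2 ^ N}. X \<omega> < W (t / 2 ^ N * real k) \<omega>) = (\<exists>s\<in>{0..t}. X \<omega> < W s \<omega>)"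
      by auto
  qed
  finally show ?thesis .
qed

context centred_brownian_motion
begin

lemma nn_integral_exp_W:
  assumes t: "0 < t" and A[measurable]: "A \<in> sets borel"
  shows "(\<integral>\<^sup>+\<omega>. ennreal (exp (c * W t \<omega>)) * indicator A (W t \<omega>) \<partial>P)
    = ennreal (exp (c * \<mu> * t + c\<^sup>2 * t / 2))
      * (\<integral>\<^sup>+y. ennreal (normal_density ((\<mu> + c) * t) (sqrt t) y) * indicator A y \<partial>lborel)"
proof -
  have tilt: "normal_density (\<mu> * t) (sqrt t) y * exp (c * y)
      = exp (c * \<mu> * t + c\<^sup>2 * t / 2) * normal_density ((\<mu> + c) * t) (sqrt t) y" for y
    using tilted_normal_density[of "sqrt t" "\<mu> * t" y c] t by (simp add: algebra_simps)
  have "(\<integral>\<^sup>+\<omega>. ennreal (exp (c * W t \<omega>)) * indicator A (W t \<omega>) \<partial>P)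
      = (\<integral>\<^sup>+y. ennreal (normal_density (\<mu> * t) (sqrt t) y) * (ennreal (exp (c * y)) * indicator A y) \<partial>lborel)"
    by (rule distributed_nn_integral[OF normal_W[OF t], symmetric]) measurable
  also have "\<dots> = (\<integral>\<^sup>+y. ennreal (exp (c * \<mu> * t + c\<^sup>2 * t / 2))
      * (ennreal (normal_density ((\<mu> + c) * t) (sqrt t) y) * indicator A y) \<partial>lborel)"
    by (intro nn_integral_cong) (simp only: mult.assoc[symmetric] ennreal_mult'[symmetric] tilt
      exp_ge_zero normal_density_nonneg)
  also have "\<dots> = ennreal (exp (c * \<mu> * t + c\<^sup>2 * t / 2))
      * (\<integral>\<^sup>+y. ennreal (normal_density ((\<mu> + c) * t) (sqrt t) y) * indicator A y \<partial>lborel)"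
    by (rule nn_integral_cmult) measurable
  finally show ?thesis .
qed

lemma nn_integral_exp_W_tail:
  assumes t: "0 < t"
  shows "(\<integral>\<^sup>+\<omega>. ennreal (exp (c * W t \<omega>)) * indicator {x<..} (W t \<omega>) \<partial>P)
    = ennreal (exp (c * \<mu> * t + c\<^sup>2 * t / 2) * std_normal_cdf (- x / sqrt t + (\<mu> + c) * sqrt t))"
proof -
  have "((\<mu> + c) * t - x) / sqrt t = - x / sqrt t + (\<mu> + c) * sqrt t"
    using t by (simp add: field_simps)
  then show ?thesis
    using nn_integral_normal_tail[of "sqrt t" "(\<mu> + c) * t" x] t
    by (simp add: nn_integral_exp_W ennreal_mult')
qed

lemma nn_integral_exp_W_finite:
  assumes t: "0 < t"
  shows "(\<integral>\<^sup>+\<omega>. ennreal (exp (c * W t \<omega>)) \<partial>P) < \<infinity>"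
proof -
  interpret N: prob_space "density lborel (normal_density ((\<mu> + c) * t) (sqrt t))"
    using t by (intro prob_space_normal_density) auto
  have "(\<integral>\<^sup>+y. ennreal (normal_density ((\<mu> + c) * t) (sqrt t) y) \<partial>lborel) = 1"
    using N.emeasure_space_1 by (simp add: emeasure_density)
  then show ?thesis using nn_integral_exp_W[OF t, of UNIV c] by simp
qed

lemma AE_W_neq: "0 < t \<Longrightarrow> AE \<omega> in P. W t \<omega> \<noteq> x"
proof -
  assume "0 < t"
  from normal_W[OF this] show ?thesis
    by (subst distributed_AE2) (auto intro: eventually_mono[OF AE_lborel_singleton[of x]])
qed

text \<open>Paths that exceed \<open>x\<close> either end above \<open>x\<close>, which is the first term, or end at or below it.  The
  latter are reflected at the level: in the limit of fine grids the first value above the level is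
  \<open>x\<close> itself, so \<open>W t\<close> is replaced by \<open>2 x - W t\<close> with the factor \<open>exp (- 2 \<mu> (W t - x))\<close>, and
  ending at or below \<open>x\<close> becomes ending above it.\<close>
lemma nn_integral_exceeds_exp_W:
  assumes t: "0 < t" and x: "0 \<le> x"
  shows "(\<integral>\<^sup>+\<omega>. (if \<exists>s\<in>{0..t}. x < W s \<omega> then ennreal (exp (a * W t \<omega>)) else 0) \<partial>P)
    = (\<integral>\<^sup>+\<omega>. ennreal (exp (a * W t \<omega>)) * indicator {x<..} (W t \<omega>) \<partial>P)
    + ennreal (exp (2 * (a + \<mu>) * x))
      * (\<integral>\<^sup>+\<omega>. ennreal (exp (- (a + 2 * \<mu>) * W t \<omega>)) * indicator {x<..} (W t \<omega>) \<partial>P)"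
proof -
  define S where "S N k \<omega> = W (t / 2 ^ N * real k) \<omega>" for N k \<omega>
  define \<kappa> where "\<kappa> N \<omega> = (LEAST k. x < S N k \<omega>)" for N \<omega>
  define hit where "hit N \<omega> \<longleftrightarrow> (\<exists>k\<le>2 ^ N. x < S N k \<omega>)" for N \<omega>
  define G where "G y = ennreal (exp (a * y)) * indicator {..x} y" for y
  define R where "R N \<omega> = (if hit N \<omega> then G (2 * S N (\<kappa> N \<omega>) \<omega> - W t \<omega>)
    * ennreal (exp (- 2 * \<mu> * (W t \<omega> - S N (\<kappa> N \<omega>) \<omega>))) else 0)" for N \<omega>
  define Lim where "Lim \<omega> = ennreal (exp (2 * (a + \<mu>) * x))
    * (ennreal (exp (- (a + 2 * \<mu>) * W t \<omega>)) * indicator {x<..} (W t \<omega>))" for \<omega>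
  \<comment> \<open>the exponents below are at most \<open>c (\<bar>x\<bar> + \<bar>W t\<bar>)\<close>, because the reflected path has \<open>x < S \<kappa> \<le> (x + W t) / 2\<close>\<close>
  define c where "c = 3 * \<bar>a\<bar> + 4 * \<bar>\<mu>\<bar>"
  define dom where "dom \<omega> = ennreal (exp (c * \<bar>x\<bar>)) * (ennreal (exp (c * W t \<omega>)) + ennreal (exp (- c * W t \<omega>)))" for \<omega>
  have [measurable]: "S N k \<in> borel_measurable P" for N k
    unfolding S_def using t by (intro measurable_W) auto
  have Wt[measurable]: "W t \<in> borel_measurable P" using t by (intro measurable_W) auto
  have [measurable]: "G \<in> borel_measurable borel" unfolding G_def by measurable
  have [measurable]: "Measurable.pred P (hit N)" for N
    unfolding hit_def by measurable
  have [measurable]: "\<kappa> N \<in> P \<rightarrow>\<^sub>M count_space UNIV" for N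
    unfolding \<kappa>_def by measurable
  have [measurable]: "(\<lambda>\<omega>. S N (\<kappa> N \<omega>) \<omega>) \<in> borel_measurable P" for N
    by (rule measurable_compose_countable[where f = "\<lambda>k \<omega>. S N k \<omega>"]) auto
  have [measurable]: "R N \<in> borel_measurable P" "Lim \<in> borel_measurable P"
      "dom \<in> borel_measurable P" for N
    unfolding R_def Lim_def dom_def by measurable
  have t_grid: "t / 2 ^ N * real (2 ^ N) = t" for N by simp
  have refl: "(\<integral>\<^sup>+\<omega>. (if hit N \<omega> then G (W t \<omega>) else 0) \<partial>P) = (\<integral>\<^sup>+\<omega>. R N \<omega> \<partial>P)" for N
    using grid_reflection[where h = "t / 2 ^ N" and G = G and x = x and n = "2 ^ N"] t
    unfolding R_def hit_def S_def \<kappa>_def t_grid by simp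
  have exceeds: "(\<exists>s\<in>{0..t}. x < W s \<omega>) \<longleftrightarrow> (\<exists>N. hit N \<omega>)" if "\<omega> \<in> space P" for \<omega>
    unfolding hit_def S_def using t
    by (intro exceeds_iff_grid_exceeds continuous_W that) auto
  have ev_hit: "\<forall>\<^sub>F N in sequentially. hit N \<omega>" if "\<omega> \<in> space P" "s \<in> {0..t}" "x < W s \<omega>" for \<omega> s
    unfolding hit_def S_def using t that
    by (intro eventually_grid_exceeds[where f = "\<lambda>s. W s \<omega>"] continuous_W) auto
  have domexp: "ennreal (exp (c * (\<bar>x\<bar> + \<bar>W t \<omega>\<bar>))) \<le> dom \<omega>" for \<omega>
  proof -
    have "exp (c * \<bar>W t \<omega>\<bar>) \<le> exp (c * W t \<omega>) + exp (- c * W t \<omega>)"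
      by (cases "0 \<le> W t \<omega>") (simp_all add: add_increasing add_increasing2)
    then have "exp (c * \<bar>x\<bar>) * exp (c * \<bar>W t \<omega>\<bar>) \<le> exp (c * \<bar>x\<bar>) * (exp (c * W t \<omega>) + exp (- c * W t \<omega>))"
      by (intro mult_left_mono) auto
    then show ?thesis
      unfolding dom_def by (simp add: ennreal_mult'[symmetric] ennreal_plus[symmetric] distrib_left exp_add del: ennreal_plus)
  qed
  have dom_fin: "(\<integral>\<^sup>+\<omega>. dom \<omega> \<partial>P) < \<infinity>"
  proof -
    have "(\<integral>\<^sup>+\<omega>. dom \<omega> \<partial>P) = ennreal (exp (c * \<bar>x\<bar>)) *
        ((\<integral>\<^sup>+\<omega>. ennreal (exp (c * W t \<omega>)) \<partial>P) + (\<integral>\<^sup>+\<omega>. ennreal (exp (- c * W t \<omega>)) \<partial>P))"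
      unfolding dom_def by (simp add: nn_integral_cmult nn_integral_add)
    then show ?thesis
      using nn_integral_exp_W_finite[OF t, of c] nn_integral_exp_W_finite[OF t, of "- c"]
      by (simp add: ennreal_mult_less_top)
  qed
  have R_dom: "R N \<omega> \<le> dom \<omega>" for N \<omega>
  proof (cases "hit N \<omega> \<and> 2 * S N (\<kappa> N \<omega>) \<omega> - W t \<omega> \<le> x")
    case True
    define v where "v = S N (\<kappa> N \<omega>) \<omega>"
    define w where "w = W t \<omega>"
    have v: "x < v" unfolding v_def \<kappa>_def using True by (auto simp: hit_def intro: LeastI)
    have vw: "2 * v - w \<le> x" using True by (simp add: v_def w_def)
    have va: "\<bar>v\<bar> \<le> \<bar>x\<bar> + \<bar>w\<bar>" using v vw by linarith
    have "a * (2 * v - w) \<le> \<bar>a\<bar> * \<bar>2 * v - w\<bar>" by (metis abs_ge_self abs_mult)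
    also have "\<dots> \<le> \<bar>a\<bar> * (3 * (\<bar>x\<bar> + \<bar>w\<bar>))" using va by (intro mult_left_mono) auto
    finally have 1: "a * (2 * v - w) \<le> \<bar>a\<bar> * (3 * (\<bar>x\<bar> + \<bar>w\<bar>))" .
    have "- 2 * \<mu> * (w - v) \<le> \<bar>\<mu>\<bar> * (2 * \<bar>w - v\<bar>)"
      using abs_ge_self[of "- 2 * \<mu> * (w - v)"] by (simp add: abs_mult)
    also have "\<dots> \<le> \<bar>\<mu>\<bar> * (4 * (\<bar>x\<bar> + \<bar>w\<bar>))"
    proof (rule mult_left_mono)
      show "2 * \<bar>w - v\<bar> \<le> 4 * (\<bar>x\<bar> + \<bar>w\<bar>)"
        using va abs_triangle_ineq4[of w v] abs_ge_zero[of x] by argo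
    qed simp
    finally have "a * (2 * v - w) + - 2 * \<mu> * (w - v) \<le> c * (\<bar>x\<bar> + \<bar>w\<bar>)"
      using 1 by (simp add: c_def algebra_simps)
    then have "exp (a * (2 * v - w)) * exp (- 2 * \<mu> * (w - v)) \<le> exp (c * (\<bar>x\<bar> + \<bar>w\<bar>))"
      unfolding exp_add[symmetric] by simp
    then have "R N \<omega> \<le> ennreal (exp (c * (\<bar>x\<bar> + \<bar>w\<bar>)))"
      using True by (simp add: R_def G_def v_def w_def ennreal_mult'[symmetric])
    also have "\<dots> \<le> dom \<omega>" unfolding w_def by (rule domexp)
    finally show ?thesis .
  qed (auto simp: R_def G_def)
  \<comment> \<open>The indicator of \<open>{..x}\<close> is discontinuous only at \<open>x\<close>, and \<open>2 x - W t\<close> almost surely avoids \<open>x\<close>.\<close>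
  have R_lim: "AE \<omega> in P. (\<lambda>N. R N \<omega>) \<longlonglongrightarrow> Lim \<omega>"
    using AE_W_neq[OF t, of x] AE_space
  proof eventually_elim
    case (elim \<omega>)
    show ?case
    proof (cases "x < W t \<omega>")
      case False
      then have w: "W t \<omega> < x" using elim by simp
      have "R N \<omega> = 0" for N
      proof (cases "hit N \<omega>")
        case True
        have "x < S N (\<kappa> N \<omega>) \<omega>"
          unfolding \<kappa>_def using True by (auto simp: hit_def intro: LeastI)
        then show ?thesis using w by (simp add: R_def G_def)
      qed (simp add: R_def)
      then show ?thesis using False by (simp add: Lim_def)
    next
      case True
      have lim: "(\<lambda>N. S N (\<kappa> N \<omega>) \<omega>) \<longlonglongrightarrow> x"
        unfolding S_def \<kappa>_def using True t x elim
        by (intro LEAST_grid_exceeds_tendsto[where f = "\<lambda>s. W s \<omega>" and s = t] continuous_W) (auto simp: centred)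
      have "(\<lambda>N. 2 * S N (\<kappa> N \<omega>) \<omega> - W t \<omega>) \<longlonglongrightarrow> 2 * x - W t \<omega>"
        by (intro tendsto_intros lim)
      then have "\<forall>\<^sub>F N in sequentially. 2 * S N (\<kappa> N \<omega>) \<omega> - W t \<omega> < x"
        by (rule order_tendstoD(2)) (use True in simp)
      moreover have "\<forall>\<^sub>F N in sequentially. hit N \<omega>"
        using True t elim by (intro ev_hit[of \<omega> t]) auto
      ultimately have eq: "\<forall>\<^sub>F N in sequentially. ennreal (exp (a * (2 * S N (\<kappa> N \<omega>) \<omega> - W t \<omega>)
          + - 2 * \<mu> * (W t \<omega> - S N (\<kappa> N \<omega>) \<omega>))) = R N \<omega>"
        by eventually_elim (simp add: R_def G_def ennreal_mult'[symmetric] exp_add[symmetric])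
      have "(\<lambda>N. ennreal (exp (a * (2 * S N (\<kappa> N \<omega>) \<omega> - W t \<omega>)
          + - 2 * \<mu> * (W t \<omega> - S N (\<kappa> N \<omega>) \<omega>))))
          \<longlonglongrightarrow> ennreal (exp (a * (2 * x - W t \<omega>) + - 2 * \<mu> * (W t \<omega> - x)))"
        by (intro tendsto_intros lim)
      also have "ennreal (exp (a * (2 * x - W t \<omega>) + - 2 * \<mu> * (W t \<omega> - x))) = Lim \<omega>"
        using True by (simp add: Lim_def ennreal_mult'[symmetric] exp_add[symmetric] algebra_simps)
      finally show ?thesis using eq by (rule Lim_transform_eventually)
    qed
  qed
  have "(\<lambda>N. \<integral>\<^sup>+\<omega>. R N \<omega> \<partial>P) \<longlonglongrightarrow> (\<integral>\<^sup>+\<omega>. Lim \<omega> \<partial>P)"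
    by (rule nn_integral_dominated_convergence[where w = dom])
       (use R_dom dom_fin R_lim in auto)
  moreover have "(\<lambda>N. \<integral>\<^sup>+\<omega>. (if hit N \<omega> then G (W t \<omega>) else 0) \<partial>P)
      \<longlonglongrightarrow> (\<integral>\<^sup>+\<omega>. (if \<exists>s\<in>{0..t}. x < W s \<omega> then G (W t \<omega>) else 0) \<partial>P)"
  proof (rule nn_integral_dominated_convergence[where w = "\<lambda>\<omega>. ennreal (exp (a * W t \<omega>))"])
    show "AE \<omega> in P. (\<lambda>N. if hit N \<omega> then G (W t \<omega>) else 0)
        \<longlonglongrightarrow> (if \<exists>s\<in>{0..t}. x < W s \<omega> then G (W t \<omega>) else 0)"
      using AE_space
    proof eventually_elim
      case (elim \<omega>)
      show ?case
      proof (cases "\<exists>s\<in>{0..t}. x < W s \<omega>")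
        case True
        then obtain s where "s \<in> {0..t}" "x < W s \<omega>" by auto
        from ev_hit[OF elim this] have "\<forall>\<^sub>F N in sequentially. G (W t \<omega>) = (if hit N \<omega> then G (W t \<omega>) else 0)"
          by eventually_elim simp
        then show ?thesis using True by (simp add: tendsto_eventually eventually_mono)
      next
        case False
        then show ?thesis using exceeds[OF elim] by simp
      qed
    qed
    show "AE \<omega> in P. (if hit j \<omega> then G (W t \<omega>) else 0) \<le> ennreal (exp (a * W t \<omega>))" for j
      by (auto simp: G_def split: split_indicator)
    show "(\<integral>\<^sup>+\<omega>. ennreal (exp (a * W t \<omega>)) \<partial>P) < \<infinity>" by (rule nn_integral_exp_W_finite[OF t])
    show "(\<lambda>\<omega>. if \<exists>s\<in>{0..t}. x < W s \<omega> then G (W t \<omega>) else 0) \<in> borel_measurable P"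
      using pred_exceeds[of t "\<lambda>_. x"] t by (intro measurable_If) auto
  qed measurable
  ultimately have *: "(\<integral>\<^sup>+\<omega>. (if \<exists>s\<in>{0..t}. x < W s \<omega> then G (W t \<omega>) else 0) \<partial>P) = (\<integral>\<^sup>+\<omega>. Lim \<omega> \<partial>P)"
    unfolding refl by (rule LIMSEQ_unique[rotated])
  have "(\<integral>\<^sup>+\<omega>. (if \<exists>s\<in>{0..t}. x < W s \<omega> then ennreal (exp (a * W t \<omega>)) else 0) \<partial>P)
      = (\<integral>\<^sup>+\<omega>. ennreal (exp (a * W t \<omega>)) * indicator {x<..} (W t \<omega>)
          + (if \<exists>s\<in>{0..t}. x < W s \<omega> then G (W t \<omega>) else 0) \<partial>P)"
  proof (rule nn_integral_cong)
    fix \<omega>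
    have "\<exists>s\<in>{0..t}. x < W s \<omega>" if "x < W t \<omega>" using that t by (intro bexI[of _ t]) auto
    then show "(if \<exists>s\<in>{0..t}. x < W s \<omega> then ennreal (exp (a * W t \<omega>)) else 0)
      = ennreal (exp (a * W t \<omega>)) * indicator {x<..} (W t \<omega>)
          + (if \<exists>s\<in>{0..t}. x < W s \<omega> then G (W t \<omega>) else 0)"
      by (auto simp: G_def split: split_indicator)
  qed
  also have "\<dots> = (\<integral>\<^sup>+\<omega>. ennreal (exp (a * W t \<omega>)) * indicator {x<..} (W t \<omega>) \<partial>P)
      + (\<integral>\<^sup>+\<omega>. (if \<exists>s\<in>{0..t}. x < W s \<omega> then G (W t \<omega>) else 0) \<partial>P)"
    using pred_exceeds[of t "\<lambda>_. x"] t by (intro nn_integral_add measurable_If) auto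
  also have "\<dots> = (\<integral>\<^sup>+\<omega>. ennreal (exp (a * W t \<omega>)) * indicator {x<..} (W t \<omega>) \<partial>P)
      + (\<integral>\<^sup>+\<omega>. Lim \<omega> \<partial>P)" unfolding * ..
  also have "(\<integral>\<^sup>+\<omega>. Lim \<omega> \<partial>P) = ennreal (exp (2 * (a + \<mu>) * x))
      * (\<integral>\<^sup>+\<omega>. ennreal (exp (- (a + 2 * \<mu>) * W t \<omega>)) * indicator {x<..} (W t \<omega>) \<partial>P)"
    unfolding Lim_def by (rule nn_integral_cmult) measurable
  finally show ?thesis .
qed

text \<open>The case \<open>a = 0\<close> of the reflection formula.\<close>
lemma prob_exceeds:
  assumes t: "0 < t" and x: "0 \<le> x"
  shows "prob {\<omega> \<in> space P. \<exists>s\<in>{0..t}. x < W s \<omega>} = passage_cdf \<mu> x t"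
proof -
  have m: "{\<omega> \<in> space P. \<exists>s\<in>{0..t}. x < W s \<omega>} \<in> events"
    using pred_exceeds[of t "\<lambda>_. x"] t by simp
  have "ennreal (prob {\<omega> \<in> space P. \<exists>s\<in>{0..t}. x < W s \<omega>})
      = (\<integral>\<^sup>+\<omega>. indicator {\<omega> \<in> space P. \<exists>s\<in>{0..t}. x < W s \<omega>} \<omega> \<partial>P)"
    using m by (simp add: emeasure_eq_measure)
  also have "\<dots> = (\<integral>\<^sup>+\<omega>. (if \<exists>s\<in>{0..t}. x < W s \<omega> then ennreal (exp (0 * W t \<omega>)) else 0) \<partial>P)"
    by (intro nn_integral_cong) (auto split: split_indicator)
  also have "\<dots> = ennreal (passage_cdf \<mu> x t)"
  proof -
    have e: "- x / sqrt t + (\<mu> + - (0 + 2 * \<mu>)) * sqrt t = - x / sqrt t - \<mu> * sqrt t"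
        "- (0 + 2 * \<mu>) * \<mu> * t + (- (0 + 2 * \<mu>))\<^sup>2 * t / 2 = 0"
      by (simp_all add: algebra_simps power2_eq_square)
    show ?thesis
      unfolding nn_integral_exceeds_exp_W[OF t x] nn_integral_exp_W_tail[OF t] passage_cdf_def e
      by (simp add: ennreal_mult'[symmetric] ennreal_plus[symmetric] cdf_def add.commute del: ennreal_plus)
  qed
  finally show ?thesis by (simp add: passage_cdf_nonneg)
qed

text \<open>The case \<open>a = - 2 \<mu>\<close>, in which the two terms of the reflection formula change places.  The weight
  is the density on the paths up to time \<open>t\<close> of drift \<open>- \<mu>\<close> with respect to drift \<open>\<mu>\<close>, which explains
  the value.\<close>
lemma nn_integral_exceeds_tilted:
  assumes t: "0 < t" and x: "0 \<le> x"
  shows "(\<integral>\<^sup>+\<omega>. (if \<exists>s\<in>{0..t}. x < W s \<omega> then ennreal (exp (- 2 * \<mu> * W t \<omega>)) else 0) \<partial>P)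
    = ennreal (passage_cdf (- \<mu>) x t)"
proof -
  have e: "- x / sqrt t + (\<mu> + - 2 * \<mu>) * sqrt t = - x / sqrt t + - \<mu> * sqrt t"
      "- x / sqrt t + (\<mu> + - (- 2 * \<mu> + 2 * \<mu>)) * sqrt t = - x / sqrt t - - \<mu> * sqrt t"
      "- 2 * \<mu> * \<mu> * t + (- 2 * \<mu>)\<^sup>2 * t / 2 = 0" "2 * (- 2 * \<mu> + \<mu>) = 2 * - \<mu>"
      "- (- 2 * \<mu> + 2 * \<mu>) = 0"
    by (simp_all add: algebra_simps power2_eq_square)
  show ?thesis
    unfolding nn_integral_exceeds_exp_W[OF t x] nn_integral_exp_W_tail[OF t] passage_cdf_def e
    by (simp add: ennreal_mult'[symmetric] ennreal_plus[symmetric] cdf_def add.commute del: ennreal_plus)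
qed

end

section \<open>Independence of the running maximum and the future supremum\<close>

lemma (in prob_space) product_distr_generatorsI:
  assumes X[measurable]: "X \<in> M \<rightarrow>\<^sub>M S" and Y[measurable]: "Y \<in> M \<rightarrow>\<^sub>M T"
    and E: "sets S = sigma_sets (space S) E" "E \<subseteq> Pow (space S)" "Int_stable E"
    and F: "sets T = sigma_sets (space T) F" "F \<subseteq> Pow (space T)" "Int_stable F"
    and eq: "\<And>A B. A \<in> E \<Longrightarrow> B \<in> F \<Longrightarrow> \<P>(\<omega> in M. X \<omega> \<in> A \<and> Y \<omega> \<in> B)
      = \<P>(\<omega> in M. X \<omega> \<in> A) * \<P>(\<omega> in M. Y \<omega> \<in> B)"
  shows "distr M S X \<Otimes>\<^sub>M distr M T Y = distr M (S \<Otimes>\<^sub>M T) (\<lambda>\<omega>. (X \<omega>, Y \<omega>))"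
proof -
  have pre: "{X -` A \<inter> space M |A. A \<in> sets S} = sigma_sets (space M) {X -` A \<inter> space M |A. A \<in> E}"
    "{Y -` A \<inter> space M |A. A \<in> sets T} = sigma_sets (space M) {Y -` A \<inter> space M |A. A \<in> F}"
    unfolding E(1) F(1) using measurable_space[OF X] measurable_space[OF Y]
    by (intro sigma_sets_vimage_commute; auto)+
  have stable: "Int_stable {Z -` A \<inter> space M |A. A \<in> G}" if "Int_stable G" for Z :: "'a \<Rightarrow> 'd" and G
  proof (rule Int_stableI)
    fix a b assume "a \<in> {Z -` A \<inter> space M |A. A \<in> G}" "b \<in> {Z -` A \<inter> space M |A. A \<in> G}"
    then obtain A B where "A \<in> G" "B \<in> G" "a = Z -` A \<inter> space M" "b = Z -` B \<inter> space M" by auto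
    then show "a \<inter> b \<in> {Z -` A \<inter> space M |A. A \<in> G}"
      using that by (intro CollectI exI[of _ "A \<inter> B"]) (auto simp: Int_stable_def)
  qed
  have "indep_set {X -` A \<inter> space M |A. A \<in> E} {Y -` A \<inter> space M |A. A \<in> F}"
    unfolding indep_sets2_eq
  proof (intro conjI ballI)
    have "A \<in> sets S" if "A \<in> E" for A using that E(1) by auto
    then show "{X -` A \<inter> space M |A. A \<in> E} \<subseteq> events" by auto
    have "A \<in> sets T" if "A \<in> F" for A using that F(1) by auto
    then show "{Y -` A \<inter> space M |A. A \<in> F} \<subseteq> events" by auto
    fix a b assume "a \<in> {X -` A \<inter> space M |A. A \<in> E}" "b \<in> {Y -` A \<inter> space M |A. A \<in> F}"
    then obtain A B where AB: "A \<in> E" "B \<in> F" and ab: "a = X -` A \<inter> space M" "b = Y -` B \<inter> space M"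
      by auto
    have "a \<inter> b = {\<omega> \<in> space M. X \<omega> \<in> A \<and> Y \<omega> \<in> B}" "a = {\<omega> \<in> space M. X \<omega> \<in> A}"
      "b = {\<omega> \<in> space M. Y \<omega> \<in> B}" unfolding ab by auto
    then show "prob (a \<inter> b) = prob a * prob b" using eq[OF AB] by simp
  qed
  from indep_set_sigma_sets[OF this stable[OF E(3)] stable[OF F(3)]]
  have ind: "indep_set {X -` A \<inter> space M |A. A \<in> sets S} {Y -` A \<inter> space M |A. A \<in> sets T}"
    unfolding pre .
  interpret S: prob_space "distr M S X" by (rule prob_space_distr) fact
  interpret T: prob_space "distr M T Y" by (rule prob_space_distr) fact
  show ?thesis
  proof (rule pair_measure_eqI)
    show "sigma_finite_measure (distr M S X)" "sigma_finite_measure (distr M T Y)" ..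
    fix A B assume "A \<in> sets (distr M S X)" "B \<in> sets (distr M T Y)"
    then have [measurable]: "A \<in> sets S" "B \<in> sets T" by auto
    have "(\<lambda>\<omega>. (X \<omega>, Y \<omega>)) -` (A \<times> B) \<inter> space M = (X -` A \<inter> space M) \<inter> (Y -` B \<inter> space M)" by auto
    moreover have "prob ((X -` A \<inter> space M) \<inter> (Y -` B \<inter> space M)) = prob (X -` A \<inter> space M) * prob (Y -` B \<inter> space M)"
      by (rule ind[unfolded indep_sets2_eq, THEN conjunct2, THEN conjunct2, rule_format]) auto
    ultimately show "emeasure (distr M S X) A * emeasure (distr M T Y) B
        = emeasure (distr M (S \<Otimes>\<^sub>M T) (\<lambda>\<omega>. (X \<omega>, Y \<omega>))) (A \<times> B)"
      by (simp add: emeasure_distr emeasure_eq_measure ennreal_mult'[symmetric])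
  qed simp
qed

lemma sets_borel_pair_greaterThan:
  "sets (borel \<Otimes>\<^sub>M borel) = sigma_sets (UNIV \<times> UNIV)
    {A \<times> B |A B. A \<in> range (\<lambda>x::real. {x<..}) \<and> B \<in> range (\<lambda>x::real. {x<..})}"
proof -
  let ?C = "range (\<lambda>n::nat. {- real n<..})"
  have C: "\<Union> ?C = UNIV"
  proof -
    have "x \<in> \<Union> ?C" for x :: real
    proof -
      obtain n where "- x < real n" using reals_Archimedean2 by blast
      then show ?thesis by (auto intro!: exI[of _ n])
    qed
    then show ?thesis by blast
  qed
  have b: "sets borel = sigma_sets UNIV (range (\<lambda>x::real. {x<..}))"
    by (subst borel_Ioi) simp
  have "sets ((borel :: real measure) \<Otimes>\<^sub>M (borel :: real measure)) = sets (sigma (space borel \<times> space borel)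
      {A \<times> B |A B. A \<in> range (\<lambda>x::real. {x<..}) \<and> B \<in> range (\<lambda>x::real. {x<..})})"
    by (rule sets_pair_eq[where Ca = ?C and Cb = ?C]) (use b C in auto)
  then show ?thesis by simp
qed

context brownian_motion
begin

definition run_max :: "real \<Rightarrow> 'a \<Rightarrow> real" where
  "run_max t \<omega> = (SUP s\<in>{0..t}. W s \<omega>)"

text \<open>Extended-real valued, so that no path has to be excluded for having an unbounded future.\<close>
definition future_sup :: "real \<Rightarrow> 'a \<Rightarrow> ereal" where
  "future_sup t \<omega> = (SUP s\<in>{0..}. ereal (W (t + s) \<omega> - W t \<omega>))"

lemma run_max_attained:
  assumes "\<omega> \<in> space P" "0 \<le> t"
  shows "\<exists>s\<in>{0..t}. W s \<omega> = run_max t \<omega> \<and> (\<forall>r\<in>{0..t}. W r \<omega> \<le> run_max t \<omega>)"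
proof -
  have "continuous_on {0..t} (\<lambda>s. W s \<omega>)"
    by (rule continuous_on_subset[OF continuous_paths[OF assms(1)]]) auto
  then obtain s where s: "s \<in> {0..t}" "\<And>r. r \<in> {0..t} \<Longrightarrow> W r \<omega> \<le> W s \<omega>"
    using continuous_attains_sup[of "{0..t}" "\<lambda>s. W s \<omega>"] assms(2) by auto
  then have "run_max t \<omega> = W s \<omega>"
    unfolding run_max_def by (intro cSup_eq_maximum) auto
  then show ?thesis using s by (intro bexI[of _ s]) auto
qed

lemma run_max_ge: "\<omega> \<in> space P \<Longrightarrow> 0 \<le> s \<Longrightarrow> s \<le> t \<Longrightarrow> W s \<omega> \<le> run_max t \<omega>"
  using run_max_attained[of \<omega> t] by auto

lemma less_run_max_iff:
  "\<omega> \<in> space P \<Longrightarrow> 0 \<le> t \<Longrightarrow> x < run_max t \<omega> \<longleftrightarrow> (\<exists>s\<in>{0..t}. x < W s \<omega>)"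
  using run_max_attained[of \<omega> t] by (metis less_le_trans)

lemma measurable_run_max[measurable]: "0 \<le> t \<Longrightarrow> run_max t \<in> borel_measurable P"
proof -
  assume t: "0 \<le> t"
  have "{\<omega> \<in> space P. x < run_max t \<omega>} = {\<omega> \<in> space P. \<exists>s\<in>{0..t}. x < W s \<omega>}" for x
    using less_run_max_iff[OF _ t] by auto
  then show ?thesis
    unfolding borel_measurable_iff_greater using pred_exceeds[of t "\<lambda>_. x" for x] t by simp
qed

lemma pred_ever_exceeds[measurable]:
  assumes "X \<in> borel_measurable P"
  shows "Measurable.pred P (\<lambda>\<omega>. \<exists>s\<ge>0. X \<omega> < W s \<omega>)"
proof -
  have "(\<lambda>\<omega>. \<exists>s\<ge>0. X \<omega> < W s \<omega>) = (\<lambda>\<omega>. \<exists>n::nat. \<exists>s\<in>{0..real n}. X \<omega> < W s \<omega>)"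
  proof (intro ext iffI)
    fix \<omega> assume "\<exists>s\<ge>0. X \<omega> < W s \<omega>"
    then obtain s where "0 \<le> s" "X \<omega> < W s \<omega>" by auto
    moreover obtain n where "s \<le> real n" using real_arch_simple by blast
    ultimately show "\<exists>n::nat. \<exists>s\<in>{0..real n}. X \<omega> < W s \<omega>"
      by (intro exI[of _ n] bexI[of _ s]) auto
  qed auto
  then show ?thesis using pred_exceeds[OF _ assms] by simp
qed

lemma less_future_sup_iff: "ereal r < future_sup t \<omega> \<longleftrightarrow> (\<exists>s\<ge>0. r < W (t + s) \<omega> - W t \<omega>)"
  unfolding future_sup_def less_SUP_iff by auto

lemma future_sup_nonneg: "0 \<le> future_sup t \<omega>"
  unfolding future_sup_def by (rule SUP_upper2[of 0]) (auto simp: zero_ereal_def)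

lemma measurable_future_sup[measurable]:
  assumes "0 \<le> t" shows "future_sup t \<in> borel_measurable P"
proof (rule borel_measurableI_greater)
  fix r :: ereal
  interpret F: centred_brownian_motion P "\<lambda>s \<omega>. W (t + s) \<omega> - W t \<omega>" \<mu>
    by (rule centred_increments) fact
  show "{\<omega> \<in> space P. r < future_sup t \<omega>} \<in> events"
  proof (cases r)
    case (real r')
    have "{\<omega> \<in> space P. r < future_sup t \<omega>} = {\<omega> \<in> space P. \<exists>s\<ge>0. r' < W (t + s) \<omega> - W t \<omega>}"
      using real less_future_sup_iff by auto
    then show ?thesis using F.pred_ever_exceeds[of "\<lambda>_. r'"] by simp
  next
    case MInf
    have "- \<infinity> < future_sup t \<omega>" for \<omega>
      using future_sup_nonneg[of t \<omega>] by (rule less_le_trans[rotated]) simp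
    then have "{\<omega> \<in> space P. r < future_sup t \<omega>} = space P" using MInf by auto
    then show ?thesis by simp
  qed simp
qed

text \<open>Later times beat the maximum over \<open>[0, t]\<close> iff the future rises by more than the drawdown at \<open>t\<close>.\<close>
lemma exceeds_run_max_iff_less_future_sup:
  assumes "\<omega> \<in> space P" "0 \<le> t"
  shows "(\<exists>s\<ge>0. run_max t \<omega> < W s \<omega>) \<longleftrightarrow> ereal (run_max t \<omega> - W t \<omega>) < future_sup t \<omega>"
proof -
  have "(\<exists>s\<ge>0. run_max t \<omega> < W s \<omega>) \<longleftrightarrow> (\<exists>s\<ge>0. run_max t \<omega> < W (t + s) \<omega>)"
  proof
    assume "\<exists>s\<ge>0. run_max t \<omega> < W s \<omega>"
    then obtain s where s: "0 \<le> s" "run_max t \<omega> < W s \<omega>" by auto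
    then have "\<not> s \<le> t" using run_max_ge[OF assms(1), of s t] by auto
    then show "\<exists>s\<ge>0. run_max t \<omega> < W (t + s) \<omega>" using s by (intro exI[of _ "s - t"]) auto
  next
    assume "\<exists>s\<ge>0. run_max t \<omega> < W (t + s) \<omega>"
    then show "\<exists>s\<ge>0. run_max t \<omega> < W s \<omega>"
      using assms(2) by (metis add_nonneg_nonneg)
  qed
  then show ?thesis unfolding less_future_sup_iff by simp
qed

end

context centred_brownian_motion
begin

text \<open>Let \<open>t\<close> tend to infinity in \<open>passage_cdf \<mu> x t = exp (2 \<mu> x) * passage_cdf (- \<mu>) x t\<close>: with the
  drift reversed the level is reached almost surely.\<close>
lemma prob_ever_exceeds:
  assumes "\<mu> < 0" "0 \<le> x"
  shows "prob {\<omega> \<in> space P. \<exists>s\<ge>0. x < W s \<omega>} = exp (2 * \<mu> * x)"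
proof -
  define A where "A n = {\<omega> \<in> space P. \<exists>s\<in>{0..real (Suc n)}. x < W s \<omega>}" for n
  have A: "range A \<subseteq> events" unfolding A_def using pred_exceeds[of "real (Suc n)" "\<lambda>_. x" for n] by auto
  have "incseq A" by (rule incseq_SucI) (auto simp: A_def intro: order.trans)
  from finite_Lim_measure_incseq[OF A this]
  have "(\<lambda>n. prob (A n)) \<longlonglongrightarrow> prob (\<Union>n. A n)" .
  also have "(\<Union>n. A n) = {\<omega> \<in> space P. \<exists>s\<ge>0. x < W s \<omega>}"
  proof -
    have "\<exists>n. s \<le> real (Suc n)" for s
    proof -
      obtain n where "s \<le> real n" using real_arch_simple by blast
      then show ?thesis by (intro exI[of _ n]) simp
    qed
    then show ?thesis unfolding A_def by fastforce
  qed
  also have "(\<lambda>n. prob (A n)) = (\<lambda>n. passage_cdf \<mu> x (real (Suc n)))"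
    unfolding A_def using assms(2) by (intro ext prob_exceeds) auto
  finally have 1: "(\<lambda>n. passage_cdf \<mu> x (real (Suc n))) \<longlonglongrightarrow> prob {\<omega> \<in> space P. \<exists>s\<ge>0. x < W s \<omega>}" .
  have "filterlim (\<lambda>n. real (Suc n)) at_top sequentially"
    by (rule filterlim_compose[OF filterlim_real_sequentially filterlim_Suc])
  then have "(\<lambda>n. exp (2 * \<mu> * x) * passage_cdf (- \<mu>) x (real (Suc n))) \<longlonglongrightarrow> exp (2 * \<mu> * x) * 1"
    using assms(1) by (intro tendsto_mult tendsto_const filterlim_compose[OF passage_cdf_at_top]) auto
  then have "(\<lambda>n. passage_cdf \<mu> x (real (Suc n))) \<longlonglongrightarrow> exp (2 * \<mu> * x)"
    using passage_cdf_uminus[of "- \<mu>" x] by simp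
  with 1 show ?thesis by (rule LIMSEQ_unique)
qed

lemma prob_less_future_sup:
  assumes "\<mu> < 0" "0 \<le> t" "0 \<le> r"
  shows "prob {\<omega> \<in> space P. ereal r < future_sup t \<omega>} = exp (2 * \<mu> * r)"
proof -
  interpret F: centred_brownian_motion P "\<lambda>s \<omega>. W (t + s) \<omega> - W t \<omega>" \<mu>
    by (rule centred_increments) fact
  show ?thesis unfolding less_future_sup_iff by (rule F.prob_ever_exceeds) fact+
qed

text \<open>On the grid of mesh \<open>t / 2 ^ N\<close> the two events concern disjoint blocks of increments.  They increase
  with \<open>N\<close> (which is why the future is observed up to time \<open>N t\<close> after \<open>t\<close>) and exhaust the events of
  the statement.\<close>
lemma prob_past_future:
  assumes t: "0 < t"
  shows "\<P>(\<omega> in P. (x < run_max t \<omega> \<and> w < W t \<omega>) \<and> ereal r < future_sup t \<omega>)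
    = \<P>(\<omega> in P. x < run_max t \<omega> \<and> w < W t \<omega>) * \<P>(\<omega> in P. ereal r < future_sup t \<omega>)"
proof -
  define h where "h N = t / 2 ^ N" for N :: nat
  have h: "0 < h N" "h N * real (2 ^ N) = t" for N using t by (simp_all add: h_def)
  define a where "a N = {\<omega> \<in> space P. (\<exists>k\<in>{..2 ^ N}. x < W (h N * real k) \<omega>) \<and> w < W t \<omega>}" for N
  define b where "b N = {\<omega> \<in> space P. \<exists>j\<in>{..N * 2 ^ N}. r < W (h N * real (2 ^ N + j)) \<omega> - W t \<omega>}" for N
  have W[measurable]: "W (h N * real k) \<in> borel_measurable P" "W t \<in> borel_measurable P" for N k
    using h(1)[of N] t by (auto intro!: measurable_W)
  have a[measurable]: "a N \<in> events" and b[measurable]: "b N \<in> events" for N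
    unfolding a_def b_def by measurable
  have ind: "prob (a N \<inter> b N) = prob (a N) * prob (b N)" for N
  proof -
    let ?k = "2 ^ N :: nat" and ?m = "N * 2 ^ N :: nat"
    let ?Pi = "\<lambda>k. PiM {..k::nat} (\<lambda>_. borel :: real measure)"
    let ?A = "{p \<in> space (?Pi ?k). (\<exists>k\<in>{..?k}. x < p k) \<and> w < p ?k}"
    let ?B = "{p \<in> space (?Pi ?m). \<exists>j\<in>{..?m}. r < p j}"
    have c: "(\<lambda>p. p j) \<in> borel_measurable (?Pi k)" if "j \<le> k" for j k
      using that by (intro measurable_component_singleton) auto
    have A: "?A \<in> sets (?Pi ?k)"
      by (intro predE pred_intros_logic pred_intros_finite borel_measurable_pred_less measurable_const c) auto
    have B: "?B \<in> sets (?Pi ?m)"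
      by (intro predE pred_intros_logic pred_intros_finite borel_measurable_pred_less measurable_const c) auto
    have sp: "(\<lambda>j\<in>{..k}. f j) \<in> space (?Pi k)" for f :: "nat \<Rightarrow> real" and k
      by (simp add: space_PiM)
    have "(\<lambda>\<omega>. \<lambda>j\<in>{..?k}. W (h N * real j) \<omega>) -` ?A \<inter> space P = a N"
      using h(2)[of N] sp by (auto simp: a_def)
    moreover have "(\<lambda>\<omega>. \<lambda>j\<in>{..?m}. W (h N * real (?k + j)) \<omega> - W (h N * real ?k) \<omega>) -` ?B \<inter> space P = b N"
      unfolding h(2) using sp by (auto simp: b_def)
    moreover have "(\<lambda>\<omega>. (\<lambda>j\<in>{..?k}. W (h N * real j) \<omega>,
        \<lambda>j\<in>{..?m}. W (h N * real (?k + j)) \<omega> - W (h N * real ?k) \<omega>)) -` (?A \<times> ?B) \<inter> space P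
      = ((\<lambda>\<omega>. \<lambda>j\<in>{..?k}. W (h N * real j) \<omega>) -` ?A \<inter> space P)
      \<inter> ((\<lambda>\<omega>. \<lambda>j\<in>{..?m}. W (h N * real (?k + j)) \<omega> - W (h N * real ?k) \<omega>) -` ?B \<inter> space P)"
      by blast
    ultimately show ?thesis
      using indep_varD[OF indep_grid_past_future[OF h(1), of ?k N ?m] A B] by simp
  qed
  have h2: "h (Suc N) * real (2 * k) = h N * real k" for N k by (simp add: h_def)
  have inc: "incseq a" "incseq b"
  proof (rule incseq_SucI; rule subsetI)
    fix N \<omega> assume "\<omega> \<in> a N"
    then obtain k where k: "k \<le> 2 ^ N" "x < W (h N * real k) \<omega>" and "\<omega> \<in> space P" "w < W t \<omega>"
      by (auto simp: a_def)
    moreover have "x < W (h (Suc N) * real (2 * k)) \<omega>" using k(2) by (simp only: h2)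
    ultimately show "\<omega> \<in> a (Suc N)"
      unfolding a_def by (intro CollectI conjI bexI[of _ "2 * k"]) simp_all
  next
    have "b N \<subseteq> b (Suc N)" for N
    proof
      fix \<omega> assume "\<omega> \<in> b N"
      then obtain j where j: "j \<le> N * 2 ^ N" "r < W (h N * real (2 ^ N + j)) \<omega> - W t \<omega>" and "\<omega> \<in> space P"
        by (auto simp: b_def)
      moreover have "2 * j \<le> Suc N * 2 ^ Suc N" using j(1) by simp
      moreover have "h N * real (2 ^ N + j) = h (Suc N) * real (2 ^ Suc N + 2 * j)"
        using h2[of N "2 ^ N + j"] by (simp add: distrib_left)
      ultimately show "\<omega> \<in> b (Suc N)"
        unfolding b_def by (intro CollectI conjI bexI[of _ "2 * j"]) (simp_all only: atMost_iff)
    qed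
    then show "incseq b" by (rule incseq_SucI)
  qed
  have Ua: "(\<Union>N. a N) = {\<omega> \<in> space P. x < run_max t \<omega> \<and> w < W t \<omega>}"
  proof -
    have "x < run_max t \<omega> \<longleftrightarrow> (\<exists>N. \<exists>k\<in>{..2 ^ N}. x < W (h N * real k) \<omega>)" if "\<omega> \<in> space P" for \<omega>
      unfolding h_def using t that less_run_max_iff[OF that, of t x]
        exceeds_iff_grid_exceeds[OF continuous_W[OF that, of t], of x] by (simp add: Bex_def)
    then show ?thesis unfolding a_def by blast
  qed
  have Ub: "(\<Union>N. b N) = {\<omega> \<in> space P. ereal r < future_sup t \<omega>}"
  proof (intro equalityI subsetI)
    fix \<omega> assume "\<omega> \<in> (\<Union>N. b N)"
    then obtain N j where "\<omega> \<in> space P" "r < W (h N * real (2 ^ N + j)) \<omega> - W t \<omega>" by (auto simp: b_def)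
    moreover have "h N * real (2 ^ N + j) = t + h N * real j" using h(2)[of N] by (simp add: distrib_left)
    ultimately show "\<omega> \<in> {\<omega> \<in> space P. ereal r < future_sup t \<omega>}"
      unfolding less_future_sup_iff using h(1)[of N] by (auto intro!: exI[of _ "h N * real j"])
  next
    fix \<omega> assume "\<omega> \<in> {\<omega> \<in> space P. ereal r < future_sup t \<omega>}"
    then obtain s where \<omega>: "\<omega> \<in> space P" and s: "0 \<le> s" "r < W (t + s) \<omega> - W t \<omega>"
      unfolding less_future_sup_iff by auto
    interpret F: centred_brownian_motion P "\<lambda>s \<omega>. W (t + s) \<omega> - W t \<omega>" \<mu>
      by (rule centred_increments) (use t in simp)
    obtain n where n: "s / t \<le> real n" using real_arch_simple by blast
    then have "s \<in> {0..real n * t}" using s(1) t by (simp add: field_simps)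
    from eventually_grid_exceeds[OF F.continuous_W[OF \<omega>] this s(2)]
    have "\<forall>\<^sub>F N in sequentially. \<exists>k\<le>2 ^ N. r < W (t + real n * t / 2 ^ N * real k) \<omega> - W t \<omega>"
      using t by simp
    then have "\<forall>\<^sub>F N in sequentially. (\<exists>k\<le>2 ^ N. r < W (t + real n * t / 2 ^ N * real k) \<omega> - W t \<omega>) \<and> n \<le> N"
      by (intro eventually_conj eventually_ge_at_top)
    then obtain N k where k: "k \<le> 2 ^ N" "r < W (t + real n * t / 2 ^ N * real k) \<omega> - W t \<omega>" "n \<le> N"
      using eventually_happens[of _ sequentially] by fastforce
    \<comment> \<open>Dyadic points of \<open>[0, n t]\<close> lie on the grid of mesh \<open>t / 2 ^ N\<close>, with index \<open>n k\<close>.\<close>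
    have "t + real n * t / 2 ^ N * real k = h N * real (2 ^ N) + h N * real (n * k)"
      unfolding h(2) by (simp add: h_def)
    also have "\<dots> = h N * real (2 ^ N + n * k)" by (simp add: distrib_left)
    finally have "\<omega> \<in> b N"
      using k \<omega> unfolding b_def by (auto intro!: bexI[of _ "n * k"] mult_le_mono)
    then show "\<omega> \<in> (\<Union>N. b N)" by auto
  qed
  have "incseq (\<lambda>N. a N \<inter> b N)" using inc by (auto simp: incseq_def) blast
  then have 1: "(\<lambda>N. prob (a N \<inter> b N)) \<longlonglongrightarrow> prob (\<Union>N. a N \<inter> b N)"
    by (intro finite_Lim_measure_incseq) auto
  have "(\<lambda>N. prob (a N) * prob (b N)) \<longlonglongrightarrow> prob (\<Union>N. a N) * prob (\<Union>N. b N)"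
    using inc by (intro tendsto_mult finite_Lim_measure_incseq) auto
  then have "prob (\<Union>N. a N \<inter> b N) = prob (\<Union>N. a N) * prob (\<Union>N. b N)"
    using LIMSEQ_unique[OF 1] by (simp add: ind)
  also have "(\<Union>N. a N \<inter> b N) = (\<Union>N. a N) \<inter> (\<Union>N. b N)"
  proof
    show "(\<Union>N. a N) \<inter> (\<Union>N. b N) \<subseteq> (\<Union>N. a N \<inter> b N)"
    proof
      fix \<omega> assume "\<omega> \<in> (\<Union>N. a N) \<inter> (\<Union>N. b N)"
      then obtain i j where "\<omega> \<in> a i" "\<omega> \<in> b j" by auto
      then have "\<omega> \<in> a (max i j) \<inter> b (max i j)"
        using incseqD[OF inc(1), of i "max i j"] incseqD[OF inc(2), of j "max i j"] by auto
      then show "\<omega> \<in> (\<Union>N. a N \<inter> b N)" by auto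
    qed
  qed auto
  also have "\<dots> = {\<omega> \<in> space P. (x < run_max t \<omega> \<and> w < W t \<omega>) \<and> ereal r < future_sup t \<omega>}"
    unfolding Ua Ub by auto
  finally show ?thesis unfolding Ua Ub .
qed

lemma product_distr_past_future:
  assumes t: "0 < t"
  shows "distr P (borel \<Otimes>\<^sub>M borel) (\<lambda>\<omega>. (run_max t \<omega>, W t \<omega>)) \<Otimes>\<^sub>M distr P borel (future_sup t)
    = distr P ((borel \<Otimes>\<^sub>M borel) \<Otimes>\<^sub>M borel) (\<lambda>\<omega>. ((run_max t \<omega>, W t \<omega>), future_sup t \<omega>))"
proof (rule product_distr_generatorsI)
  have [measurable]: "W t \<in> borel_measurable P" "run_max t \<in> borel_measurable P"
    using t by (auto intro!: measurable_W measurable_run_max)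
  show "(\<lambda>\<omega>. (run_max t \<omega>, W t \<omega>)) \<in> P \<rightarrow>\<^sub>M borel \<Otimes>\<^sub>M borel" by measurable
  show "future_sup t \<in> borel_measurable P" using t by (intro measurable_future_sup) simp
  let ?E = "{A \<times> B |A B. A \<in> range (\<lambda>x::real. {x<..}) \<and> B \<in> range (\<lambda>x::real. {x<..})}"
  show "sets (borel \<Otimes>\<^sub>M borel) = sigma_sets (space (borel \<Otimes>\<^sub>M borel)) ?E"
    using sets_borel_pair_greaterThan by (simp add: space_pair_measure)
  show "?E \<subseteq> Pow (space (borel \<Otimes>\<^sub>M borel))" by (simp add: space_pair_measure)
  show "Int_stable ?E"
  proof (rule Int_stableI)
    fix a b assume "a \<in> ?E" "b \<in> ?E"
    then obtain x y x' y' where ab: "a = {x<..} \<times> {y<..}" "b = {x'<..} \<times> {y'<..}" by auto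
    have "a \<inter> b = {max x x'<..} \<times> {max y y'<..}" unfolding ab by auto
    then show "a \<inter> b \<in> ?E" by blast
  qed
  let ?F = "range (\<lambda>r::ereal. {r<..})"
  show "sets borel = sigma_sets (space borel) ?F" by (subst borel_Ioi) simp
  show "?F \<subseteq> Pow (space borel)" by simp
  show "Int_stable ?F"
  proof (rule Int_stableI)
    fix a b assume "a \<in> ?F" "b \<in> ?F"
    then obtain r s where "a = {r<..}" "b = {s<..}" by auto
    then have "a \<inter> b = {max r s<..}" by auto
    then show "a \<inter> b \<in> ?F" by blast
  qed
  fix A B assume "A \<in> ?E" "B \<in> ?F"
  then obtain x w r where AB: "A = {x<..} \<times> {w<..}" "B = {r<..}" by auto
  show "\<P>(\<omega> in P. (run_max t \<omega>, W t \<omega>) \<in> A \<and> future_sup t \<omega> \<in> B)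
      = \<P>(\<omega> in P. (run_max t \<omega>, W t \<omega>) \<in> A) * \<P>(\<omega> in P. future_sup t \<omega> \<in> B)"
  proof (cases r)
    case (real r')
    then show ?thesis using prob_past_future[OF t, of x w r'] by (simp add: AB)
  next
    case MInf
    have "- \<infinity> < future_sup t \<omega>" for \<omega>
      using future_sup_nonneg[of t \<omega>] by (rule less_le_trans[rotated]) simp
    then show ?thesis by (simp add: AB MInf prob_space)
  qed (simp add: AB)
qed

section \<open>The joint distribution function of the maximum and its location\<close>

text \<open>The event says that the maximum over \<open>[0, t]\<close> is more than \<open>x\<close> and final.  Its complement \<open>A\<close> within
  \<open>{x < m_t}\<close> has probability \<open>E (exp (2 \<mu> (m_t - W_t)); x < m_t)\<close> by independence of the future.
  Adding the claimed value \<open>I\<close>, rewritten by Fubini as an expectation over \<open>x < m_t\<close>, the terms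
  \<open>exp (2 \<mu> m_t)\<close> cancel, and what is left is the probability of \<open>{x < m_t}\<close>.  Working with sums
  rather than differences keeps all integrals nonnegative.\<close>

lemma emeasure_run_max_final_centred:
  assumes \<mu>: "\<mu> < 0" and t: "0 < t" and x: "0 \<le> x"
  shows "emeasure P {\<omega> \<in> space P. x < run_max t \<omega> \<and> \<not> (\<exists>s\<ge>0. run_max t \<omega> < W s \<omega>)}
    = (\<integral>\<^sup>+y. ennreal (- 2 * \<mu> * exp (2 * \<mu> * y)) * ennreal (passage_cdf (- \<mu>) y t) * indicator {x<..} y \<partial>lborel)"
proof -
  let ?m = "run_max t" and ?w = "W t" and ?R = "future_sup t"
  have t0: "0 \<le> t" using t by simp
  have [measurable]: "?w \<in> borel_measurable P" "?m \<in> borel_measurable P" "?R \<in> borel_measurable P"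
    using t0 by (auto intro!: measurable_W measurable_run_max measurable_future_sup)
  \<comment> \<open>\<open>A\<close>: the maximum over \<open>[0, t]\<close> is exceeded later; \<open>B\<close>: it is final\<close>
  define A where "A = {\<omega> \<in> space P. x < ?m \<omega> \<and> ereal (?m \<omega> - ?w \<omega>) < ?R \<omega>}"
  define B where "B = {\<omega> \<in> space P. x < ?m \<omega> \<and> \<not> ereal (?m \<omega> - ?w \<omega>) < ?R \<omega>}"
  have [measurable]: "A \<in> events" "B \<in> events" unfolding A_def B_def by measurable
  define I where "I = (\<integral>\<^sup>+y. ennreal (- 2 * \<mu> * exp (2 * \<mu> * y)) * ennreal (passage_cdf (- \<mu>) y t)
    * indicator {x<..} y \<partial>lborel)"
  define J where "J = (\<integral>\<^sup>+\<omega>. (if x < ?m \<omega> then ennreal (exp (2 * \<mu> * x) * exp (- 2 * \<mu> * ?w \<omega>)) else 0) \<partial>P)"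
  have tilted: "(\<integral>\<^sup>+\<omega>. (if y < ?m \<omega> then ennreal (exp (- 2 * \<mu> * ?w \<omega>)) else 0) \<partial>P)
      = ennreal (passage_cdf (- \<mu>) y t)" if "0 \<le> y" for y
    unfolding nn_integral_exceeds_tilted[OF t that, symmetric]
    by (intro nn_integral_cong) (simp add: less_run_max_iff t0)
  have "J = (\<integral>\<^sup>+\<omega>. ennreal (exp (2 * \<mu> * x)) * (if x < ?m \<omega> then ennreal (exp (- 2 * \<mu> * ?w \<omega>)) else 0) \<partial>P)"
    unfolding J_def by (intro nn_integral_cong) (simp add: ennreal_mult')
  also have "\<dots> = ennreal (exp (2 * \<mu> * x)) * ennreal (passage_cdf (- \<mu>) x t)"
    by (subst nn_integral_cmult) (auto simp: tilted x)
  also have "\<dots> = ennreal (passage_cdf \<mu> x t)"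
    using passage_cdf_uminus[of "- \<mu>" x t] by (simp add: ennreal_mult')
  also have "\<dots> = emeasure P {\<omega> \<in> space P. x < ?m \<omega>}"
    using prob_exceeds[OF t x] less_run_max_iff[OF _ t0, of _ x]
    by (simp add: emeasure_eq_measure cong: conj_cong)
  also have "{\<omega> \<in> space P. x < ?m \<omega>} = A \<union> B" unfolding A_def B_def by auto
  also have "emeasure P (A \<union> B) = emeasure P A + emeasure P B"
    by (rule plus_emeasure[symmetric]) (auto simp: A_def B_def)
  finally have J: "J = emeasure P A + emeasure P B" .
  have A: "emeasure P A = (\<integral>\<^sup>+\<omega>. (if x < ?m \<omega> then ennreal (exp (2 * \<mu> * (?m \<omega> - ?w \<omega>))) else 0) \<partial>P)"
  proof -
    let ?F = "\<lambda>z. if x < fst (fst z) \<and> ereal (fst (fst z) - snd (fst z)) < snd z then 1 else (0::ennreal)"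
    have "emeasure P A = (\<integral>\<^sup>+\<omega>. indicator A \<omega> \<partial>P)" by simp
    also have "\<dots> = (\<integral>\<^sup>+\<omega>. ?F ((?m \<omega>, ?w \<omega>), ?R \<omega>) \<partial>P)"
      by (intro nn_integral_cong) (auto simp: A_def split: split_indicator)
    also have "\<dots> = (\<integral>\<^sup>+\<omega>. (\<integral>\<^sup>+\<omega>'. ?F ((?m \<omega>, ?w \<omega>), ?R \<omega>') \<partial>P) \<partial>P)"
      by (rule nn_integral_product_distr[OF _ _ product_distr_past_future[OF t]]) measurable
    also have "\<dots> = (\<integral>\<^sup>+\<omega>. (if x < ?m \<omega> then ennreal (exp (2 * \<mu> * (?m \<omega> - ?w \<omega>))) else 0) \<partial>P)"
    proof (rule nn_integral_cong)
      fix \<omega> assume \<omega>: "\<omega> \<in> space P"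
      then have "0 \<le> ?m \<omega> - ?w \<omega>" using run_max_ge[OF \<omega> t0] by simp
      from prob_less_future_sup[OF \<mu> t0 this]
      have "emeasure P {\<omega>' \<in> space P. ereal (?m \<omega> - ?w \<omega>) < ?R \<omega>'} = ennreal (exp (2 * \<mu> * (?m \<omega> - ?w \<omega>)))"
        by (simp add: emeasure_eq_measure)
      moreover have "(\<integral>\<^sup>+\<omega>'. (if ereal (?m \<omega> - ?w \<omega>) < ?R \<omega>' then 1 else 0) \<partial>P)
          = (\<integral>\<^sup>+\<omega>'. indicator {\<omega>' \<in> space P. ereal (?m \<omega> - ?w \<omega>) < ?R \<omega>'} \<omega>' \<partial>P)"
        by (intro nn_integral_cong) (auto split: split_indicator)
      ultimately show "(\<integral>\<^sup>+\<omega>'. ?F ((?m \<omega>, ?w \<omega>), ?R \<omega>') \<partial>P)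
          = (if x < ?m \<omega> then ennreal (exp (2 * \<mu> * (?m \<omega> - ?w \<omega>))) else 0)"
        by simp
    qed
    finally show ?thesis .
  qed
  have I: "I = (\<integral>\<^sup>+\<omega>. (if x < ?m \<omega> then ennreal ((exp (2 * \<mu> * x) - exp (2 * \<mu> * ?m \<omega>)) * exp (- 2 * \<mu> * ?w \<omega>)) else 0) \<partial>P)"
  proof -
    interpret PL: pair_sigma_finite P lborel ..
    have "I = (\<integral>\<^sup>+y. (\<integral>\<^sup>+\<omega>. ennreal (- 2 * \<mu> * exp (2 * \<mu> * y)) * indicator {x<..} y
        * (if y < ?m \<omega> then ennreal (exp (- 2 * \<mu> * ?w \<omega>)) else 0) \<partial>P) \<partial>lborel)"
      unfolding I_def
    proof (rule nn_integral_cong)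
      fix y :: real
      show "ennreal (- 2 * \<mu> * exp (2 * \<mu> * y)) * ennreal (passage_cdf (- \<mu>) y t) * indicator {x<..} y
        = (\<integral>\<^sup>+\<omega>. ennreal (- 2 * \<mu> * exp (2 * \<mu> * y)) * indicator {x<..} y
        * (if y < ?m \<omega> then ennreal (exp (- 2 * \<mu> * ?w \<omega>)) else 0) \<partial>P)"
        using tilted[of y] x by (subst nn_integral_cmult) (auto split: split_indicator)
    qed
    also have "\<dots> = (\<integral>\<^sup>+\<omega>. (\<integral>\<^sup>+y. ennreal (- 2 * \<mu> * exp (2 * \<mu> * y)) * indicator {x<..} y
        * (if y < ?m \<omega> then ennreal (exp (- 2 * \<mu> * ?w \<omega>)) else 0) \<partial>lborel) \<partial>P)"
      by (rule PL.Fubini') measurable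
    also have "\<dots> = (\<integral>\<^sup>+\<omega>. (if x < ?m \<omega> then ennreal ((exp (2 * \<mu> * x) - exp (2 * \<mu> * ?m \<omega>)) * exp (- 2 * \<mu> * ?w \<omega>)) else 0) \<partial>P)"
    proof (rule nn_integral_cong)
      fix \<omega>
      let ?c = "ennreal (exp (- 2 * \<mu> * ?w \<omega>))"
      show "(\<integral>\<^sup>+y. ennreal (- 2 * \<mu> * exp (2 * \<mu> * y)) * indicator {x<..} y
          * (if y < ?m \<omega> then ?c else 0) \<partial>lborel)
        = (if x < ?m \<omega> then ennreal ((exp (2 * \<mu> * x) - exp (2 * \<mu> * ?m \<omega>)) * exp (- 2 * \<mu> * ?w \<omega>)) else 0)"
      proof (cases "x < ?m \<omega>")
        case True
        have "(\<integral>\<^sup>+y. ennreal (- 2 * \<mu> * exp (2 * \<mu> * y)) * indicator {x<..} y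
            * (if y < ?m \<omega> then ?c else 0) \<partial>lborel)
          = (\<integral>\<^sup>+y. ennreal (- 2 * \<mu> * exp (2 * \<mu> * y)) * indicator {x..?m \<omega>} y * ?c \<partial>lborel)"
        proof (rule nn_integral_cong_AE)
          show "AE y in lborel. ennreal (- 2 * \<mu> * exp (2 * \<mu> * y)) * indicator {x<..} y
              * (if y < ?m \<omega> then ?c else 0) = ennreal (- 2 * \<mu> * exp (2 * \<mu> * y)) * indicator {x..?m \<omega>} y * ?c"
            using AE_lborel_singleton[of x] AE_lborel_singleton[of "?m \<omega>"]
            by eventually_elim (auto split: split_indicator)
        qed
        also have "\<dots> = (\<integral>\<^sup>+y. ennreal (- 2 * \<mu> * exp (2 * \<mu> * y)) * indicator {x..?m \<omega>} y \<partial>lborel) * ?c"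
          by (rule nn_integral_multc) measurable
        also have "(\<integral>\<^sup>+y. ennreal (- 2 * \<mu> * exp (2 * \<mu> * y)) * indicator {x..?m \<omega>} y \<partial>lborel)
            = ennreal (- exp (2 * \<mu> * ?m \<omega>) - - exp (2 * \<mu> * x))"
          using \<mu> True by (intro nn_integral_FTC_Icc[where F = "\<lambda>y. - exp (2 * \<mu> * y)"])
            (auto intro!: derivative_eq_intros simp: mult_nonpos_nonneg)
        finally show ?thesis using True by (simp add: ennreal_mult'')
      next
        case False
        then have z: "ennreal (- 2 * \<mu> * exp (2 * \<mu> * y)) * indicator {x<..} y * (if y < ?m \<omega> then ?c else 0) = 0" for y
          by (auto split: split_indicator)
        show ?thesis unfolding z using False by simp
      qed
    qed
    finally show ?thesis .
  qed
  have "emeasure P A + I = J"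
  proof -
    have "emeasure P A + I = (\<integral>\<^sup>+\<omega>. (if x < ?m \<omega> then ennreal (exp (2 * \<mu> * (?m \<omega> - ?w \<omega>))) else 0)
      + (if x < ?m \<omega> then ennreal ((exp (2 * \<mu> * x) - exp (2 * \<mu> * ?m \<omega>)) * exp (- 2 * \<mu> * ?w \<omega>)) else 0) \<partial>P)"
      unfolding A I by (rule nn_integral_add[symmetric]) measurable
    also have "\<dots> = J"
      unfolding J_def
    proof (rule nn_integral_cong)
      fix \<omega>
      have e: "exp (2 * \<mu> * (?m \<omega> - ?w \<omega>)) = exp (2 * \<mu> * ?m \<omega>) * exp (- 2 * \<mu> * ?w \<omega>)"
        by (simp add: exp_add[symmetric] algebra_simps)
      have "exp (2 * \<mu> * ?m \<omega>) \<le> exp (2 * \<mu> * x)" if "x < ?m \<omega>"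
        using that \<mu> by simp
      then show "(if x < ?m \<omega> then ennreal (exp (2 * \<mu> * (?m \<omega> - ?w \<omega>))) else 0)
        + (if x < ?m \<omega> then ennreal ((exp (2 * \<mu> * x) - exp (2 * \<mu> * ?m \<omega>)) * exp (- 2 * \<mu> * ?w \<omega>)) else 0)
        = (if x < ?m \<omega> then ennreal (exp (2 * \<mu> * x) * exp (- 2 * \<mu> * ?w \<omega>)) else 0)"
        unfolding e by (simp add: ennreal_plus[symmetric] algebra_simps del: ennreal_plus)
    qed
    finally show ?thesis .
  qed
  then have "emeasure P A + I = emeasure P A + emeasure P B" unfolding J .
  then have "I = emeasure P B" by (simp add: ennreal_add_left_cancel)
  moreover have "B = {\<omega> \<in> space P. x < ?m \<omega> \<and> \<not> (\<exists>s\<ge>0. ?m \<omega> < W s \<omega>)}"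
    unfolding B_def using exceeds_run_max_iff_less_future_sup[OF _ t0] by auto
  ultimately show ?thesis unfolding I_def by simp
qed

end

text \<open>Passage times look at the open interval, running maxima at the closed one; by continuity the end
  points make no difference.\<close>
lemma exceeds_iff_exceeds_interior:
  fixes f :: "real \<Rightarrow> real"
  assumes "continuous_on {0..b} f" "0 < b"
  shows "(\<exists>s\<in>{0..b}. x < f s) \<longleftrightarrow> (\<exists>s. 0 < s \<and> s < b \<and> x < f s)"
proof
  assume "\<exists>s\<in>{0..b}. x < f s"
  then obtain s where s: "s \<in> {0..b}" "x < f s" by auto
  show "\<exists>s. 0 < s \<and> s < b \<and> x < f s"
  proof (rule ccontr)
    assume "\<not> ?thesis"
    then have le: "\<And>r. r \<in> {0<..<b} \<Longrightarrow> f r \<le> x" by (meson greaterThanLessThan_iff not_less)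
    have "f s \<le> x"
      by (rule continuous_le_on_closure[of "{0<..<b}" f s x]) (use assms s(1) le in auto)
    then show False using s(2) by simp
  qed
qed auto

context brownian_motion
begin

lemma centred_version: "centred_brownian_motion P (\<lambda>s \<omega>. W s \<omega> - W 0 \<omega>) \<mu>"
  using centred_increments[of 0] by simp

lemma prob_passage_time_less:
  assumes t: "0 < t" and x: "0 \<le> x"
  shows "\<P>(\<omega> in P. passage_time W x \<omega> < ereal t) = passage_cdf \<mu> x t"
proof -
  interpret V: centred_brownian_motion P "\<lambda>s \<omega>. W s \<omega> - W 0 \<omega>" \<mu> by (rule centred_version)
  have "passage_time W x \<omega> < ereal t \<longleftrightarrow> (\<exists>s\<in>{0..t}. x < W s \<omega>)" if "\<omega> \<in> space P" for \<omega>
  proof -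
    have "continuous_on {0..t} (\<lambda>s. W s \<omega>)"
      by (rule continuous_on_subset[OF continuous_paths[OF that]]) auto
    from exceeds_iff_exceeds_interior[OF this t, of x] show ?thesis
      unfolding passage_time_def INF_less_iff by auto
  qed
  then have "\<P>(\<omega> in P. passage_time W x \<omega> < ereal t) = prob {\<omega> \<in> space P. \<exists>s\<in>{0..t}. x < W s \<omega>}"
    by (intro arg_cong[where f = prob]) auto
  also have "\<dots> = prob {\<omega> \<in> space P. \<exists>s\<in>{0..t}. x < W s \<omega> - W 0 \<omega>}"
  proof (rule measure_eq_AE)
    show "AE \<omega> in P. (\<omega> \<in> {\<omega> \<in> space P. \<exists>s\<in>{0..t}. x < W s \<omega>})
        = (\<omega> \<in> {\<omega> \<in> space P. \<exists>s\<in>{0..t}. x < W s \<omega> - W 0 \<omega>})"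
      using start_zero by eventually_elim simp
  qed (use t pred_exceeds[of t "\<lambda>_. x"] V.pred_exceeds[of t "\<lambda>_. x"] in auto)
  also have "\<dots> = passage_cdf \<mu> x t" by (rule V.prob_exceeds[OF t x])
  finally show ?thesis .
qed

text \<open>On paths that are not bounded above the value is one fixed real number, the least element of an
  empty set, so these paths contribute either nothing or all of a measurable set.\<close>
lemma path_sup_measurable: "path_sup W \<in> borel_measurable P"
proof -
  have bdd: "bdd_above ((\<lambda>t. W t \<omega>) ` {0..}) \<longleftrightarrow> (\<exists>n::nat. \<not> (\<exists>s\<ge>0. real n < W s \<omega>))" for \<omega>
  proof
    assume "bdd_above ((\<lambda>t. W t \<omega>) ` {0..})"
    then obtain B where B: "\<And>s. 0 \<le> s \<Longrightarrow> W s \<omega> \<le> B" by (auto simp: bdd_above_def)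
    obtain n where "B \<le> real n" using real_arch_simple by blast
    then have "\<not> (\<exists>s\<ge>0. real n < W s \<omega>)" using B by (meson order.trans not_less)
    then show "\<exists>n::nat. \<not> (\<exists>s\<ge>0. real n < W s \<omega>)" by blast
  next
    assume "\<exists>n::nat. \<not> (\<exists>s\<ge>0. real n < W s \<omega>)"
    then show "bdd_above ((\<lambda>t. W t \<omega>) ` {0..})" unfolding bdd_above_def by (auto simp: not_less)
  qed
  have unbounded: "path_sup W \<omega> = (LEAST z::real. False)" if "\<not> bdd_above ((\<lambda>t. W t \<omega>) ` {0..})" for \<omega>
  proof -
    have "(\<lambda>z. \<forall>y\<in>(\<lambda>t. W t \<omega>) ` {0..}. y \<le> z) = (\<lambda>z. False)"
      using that by (auto simp: bdd_above_def fun_eq_iff)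
    then show ?thesis unfolding path_sup_def Sup_real_def by simp
  qed
  have "x < path_sup W \<omega> \<longleftrightarrow> (\<exists>n::nat. \<not> (\<exists>s\<ge>0. real n < W s \<omega>)) \<and> (\<exists>s\<ge>0. x < W s \<omega>)
      \<or> \<not> (\<exists>n::nat. \<not> (\<exists>s\<ge>0. real n < W s \<omega>)) \<and> x < (LEAST z::real. False)" for x \<omega>
  proof (cases "bdd_above ((\<lambda>t. W t \<omega>) ` {0..})")
    case True
    then have "x < path_sup W \<omega> \<longleftrightarrow> (\<exists>s\<ge>0. x < W s \<omega>)"
      unfolding path_sup_def by (subst less_cSUP_iff) auto
    then show ?thesis using True[unfolded bdd] by argo
  next
    case False
    then show ?thesis using unbounded[OF False] False[unfolded bdd] by argo
  qed
  note eq = this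
  have exc: "Measurable.pred P (\<lambda>\<omega>. \<exists>s\<ge>0. c < W s \<omega>)" for c
    by (rule pred_ever_exceeds) simp
  show ?thesis
    unfolding borel_measurable_iff_greater eq
    by (intro allI predE pred_intros_logic pred_intros_countable exc) auto
qed

definition maximisers :: "'a \<Rightarrow> real set" where
  "maximisers \<omega> = {t. is_arg_max (\<lambda>t. W t \<omega>) (\<lambda>t. 0 \<le> t) t}"

lemma maximisers_iff: "t \<in> maximisers \<omega> \<longleftrightarrow> 0 \<le> t \<and> (\<forall>s\<ge>0. W s \<omega> \<le> W t \<omega>)"
  by (auto simp: maximisers_def is_arg_max_linorder)

lemma path_argsup_eq: "path_argsup W \<omega> = Inf (maximisers \<omega>)"
  by (simp add: path_argsup_def maximisers_def)

text \<open>The set of maximisers is closed by continuity, so the first one exists.\<close>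
lemma path_argsup_in_maximisers:
  assumes "\<omega> \<in> space P" "maximisers \<omega> \<noteq> {}"
  shows "path_argsup W \<omega> \<in> maximisers \<omega>"
proof -
  have "maximisers \<omega> = (\<Inter>s\<in>{0..}. {t\<in>{0..}. W s \<omega> \<le> W t \<omega>})"
  proof (intro set_eqI iffI)
    fix t assume t: "t \<in> (\<Inter>s\<in>{0..}. {t\<in>{0..}. W s \<omega> \<le> W t \<omega>})"
    have "0 \<le> t \<and> W s \<omega> \<le> W t \<omega>" if "0 \<le> s" for s using t that by simp
    from this[of 0] this show "t \<in> maximisers \<omega>" by (simp add: maximisers_iff)
  qed (simp add: maximisers_iff)
  moreover have "closed {t\<in>{0..}. W s \<omega> \<le> W t \<omega>}" for s
    by (intro continuous_on_closed_Collect_le continuous_paths assms continuous_on_const) auto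
  ultimately have "closed (maximisers \<omega>)" by auto
  moreover have "bdd_below (maximisers \<omega>)" by (rule bdd_belowI[of _ 0]) (simp add: maximisers_iff)
  ultimately show ?thesis
    unfolding path_argsup_eq using assms(2) by (intro closed_contains_Inf)
qed

lemma maximiser_le_iff:
  assumes "\<omega> \<in> space P" "0 \<le> t"
  shows "(\<exists>a\<in>maximisers \<omega>. a \<le> t) \<longleftrightarrow> \<not> (\<exists>s\<ge>0. run_max t \<omega> < W s \<omega>)"
proof
  assume "\<exists>a\<in>maximisers \<omega>. a \<le> t"
  then obtain a where a: "0 \<le> a" "a \<le> t" "\<And>s. 0 \<le> s \<Longrightarrow> W s \<omega> \<le> W a \<omega>" by (auto simp: maximisers_iff)
  then have "W a \<omega> \<le> run_max t \<omega>" by (intro run_max_ge assms)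
  with a(3) show "\<not> (\<exists>s\<ge>0. run_max t \<omega> < W s \<omega>)" by (meson not_less order.trans)
next
  assume "\<not> (\<exists>s\<ge>0. run_max t \<omega> < W s \<omega>)"
  with run_max_attained[OF assms] show "\<exists>a\<in>maximisers \<omega>. a \<le> t"
    by (auto simp: maximisers_iff not_less)
qed

lemma path_argsup_le_iff:
  assumes "\<omega> \<in> space P" "0 \<le> t" "maximisers \<omega> \<noteq> {}"
  shows "path_argsup W \<omega> \<le> t \<longleftrightarrow> \<not> (\<exists>s\<ge>0. run_max t \<omega> < W s \<omega>)"
proof -
  have "path_argsup W \<omega> \<le> t \<longleftrightarrow> (\<exists>a\<in>maximisers \<omega>. a \<le> t)"
  proof
    assume "\<exists>a\<in>maximisers \<omega>. a \<le> t"
    then obtain a where "a \<in> maximisers \<omega>" "a \<le> t" by auto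
    moreover have "bdd_below (maximisers \<omega>)" by (rule bdd_belowI[of _ 0]) (simp add: maximisers_iff)
    ultimately show "path_argsup W \<omega> \<le> t" unfolding path_argsup_eq by (auto intro: cInf_lower2)
  qed (use path_argsup_in_maximisers[OF assms(1,3)] in blast)
  then show ?thesis using maximiser_le_iff[OF assms(1,2)] by simp
qed

lemma path_sup_eq_maximum: "a \<in> maximisers \<omega> \<Longrightarrow> path_sup W \<omega> = W a \<omega>"
  unfolding path_sup_def by (rule cSup_eq_maximum) (auto simp: maximisers_iff)

lemma path_sup_eq_run_max:
  assumes "\<omega> \<in> space P" "0 \<le> t" "\<not> (\<exists>s\<ge>0. run_max t \<omega> < W s \<omega>)"
  shows "path_sup W \<omega> = run_max t \<omega>"
proof -
  obtain a where a: "a \<in> {0..t}" "W a \<omega> = run_max t \<omega>" using run_max_attained[OF assms(1,2)] by auto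
  then have "a \<in> maximisers \<omega>" using assms(3) by (auto simp: maximisers_iff not_less)
  from path_sup_eq_maximum[OF this] a show ?thesis by simp
qed

lemma maximisers_nonempty_iff:
  assumes "\<omega> \<in> space P"
  shows "maximisers \<omega> \<noteq> {} \<longleftrightarrow> (\<exists>n::nat. \<not> (\<exists>s\<ge>0. run_max (real n) \<omega> < W s \<omega>))"
proof
  assume "maximisers \<omega> \<noteq> {}"
  then obtain a where a: "a \<in> maximisers \<omega>" by auto
  obtain n where "a \<le> real n" using real_arch_simple by blast
  then show "\<exists>n::nat. \<not> (\<exists>s\<ge>0. run_max (real n) \<omega> < W s \<omega>)"
    using a maximiser_le_iff[OF assms, of "real n"] by auto
next
  assume "\<exists>n::nat. \<not> (\<exists>s\<ge>0. run_max (real n) \<omega> < W s \<omega>)"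
  then obtain n :: nat where "\<not> (\<exists>s\<ge>0. run_max (real n) \<omega> < W s \<omega>)" by auto
  then have "\<exists>a\<in>maximisers \<omega>. a \<le> real n"
    using maximiser_le_iff[OF assms, of "real n"] by auto
  then show "maximisers \<omega> \<noteq> {}" by auto
qed

lemma pred_exceeds_run_max[measurable]: "0 \<le> t \<Longrightarrow> Measurable.pred P (\<lambda>\<omega>. \<exists>s\<ge>0. run_max t \<omega> < W s \<omega>)"
  by (intro pred_ever_exceeds measurable_run_max)

text \<open>Attaining the maximum by time \<open>t\<close> means that the maximum over \<open>[0, t]\<close> is never exceeded.  If it is
  not attained at all, the value is the constant \<open>Inf {}\<close>.\<close>
lemma path_argsup_measurable: "path_argsup W \<in> borel_measurable P"
proof -
  let ?peak = "\<lambda>t \<omega>. \<not> (\<exists>s\<ge>0. run_max t \<omega> < W s \<omega>)"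
  have eq: "path_argsup W \<omega> \<le> t \<longleftrightarrow> (\<exists>n::nat. ?peak (real n) \<omega>) \<and> 0 \<le> t \<and> ?peak (max 0 t) \<omega>
      \<or> \<not> (\<exists>n::nat. ?peak (real n) \<omega>) \<and> Inf {} \<le> t" if \<omega>: "\<omega> \<in> space P" for t \<omega>
  proof (cases "maximisers \<omega> = {}")
    case True
    then have "\<not> (\<exists>n::nat. ?peak (real n) \<omega>)" using maximisers_nonempty_iff[OF \<omega>] by blast
    then show ?thesis unfolding path_argsup_eq True by blast
  next
    case False
    then have ne: "\<exists>n::nat. ?peak (real n) \<omega>" using maximisers_nonempty_iff[OF \<omega>] by blast
    have "0 \<le> path_argsup W \<omega>"
      using path_argsup_in_maximisers[OF \<omega> False] by (simp add: maximisers_iff)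
    moreover have "path_argsup W \<omega> \<le> max 0 t \<longleftrightarrow> ?peak (max 0 t) \<omega>"
      by (rule path_argsup_le_iff[OF \<omega> _ False]) simp
    moreover have "max 0 t = t \<and> 0 \<le> t \<or> max 0 t = 0 \<and> t < 0" by auto
    ultimately have "path_argsup W \<omega> \<le> t \<longleftrightarrow> 0 \<le> t \<and> ?peak (max 0 t) \<omega>"
      by (metis order.trans not_less)
    then show ?thesis using ne by blast
  qed
  then have "{\<omega> \<in> space P. path_argsup W \<omega> \<le> t} = {\<omega> \<in> space P.
      (\<exists>n::nat. ?peak (real n) \<omega>) \<and> 0 \<le> t \<and> ?peak (max 0 t) \<omega>
      \<or> \<not> (\<exists>n::nat. ?peak (real n) \<omega>) \<and> Inf {} \<le> t}" for t
    by (intro Collect_cong conj_cong refl)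
  note eq = this
  show ?thesis
    unfolding borel_measurable_iff_le eq
    by (intro allI predE pred_intros_logic pred_intros_countable pred_exceeds_run_max) auto
qed

text \<open>The centred version and the process itself agree wherever \<open>W 0 = 0\<close>, that is, almost surely.\<close>
lemma emeasure_run_max_final:
  assumes \<mu>: "\<mu> < 0" and t: "0 < t" and x: "0 \<le> x"
  shows "emeasure P {\<omega> \<in> space P. x < run_max t \<omega> \<and> \<not> (\<exists>s\<ge>0. run_max t \<omega> < W s \<omega>)}
    = (\<integral>\<^sup>+y. ennreal (- 2 * \<mu> * exp (2 * \<mu> * y)) * ennreal (passage_cdf (- \<mu>) y t) * indicator {x<..} y \<partial>lborel)"
proof -
  interpret V: centred_brownian_motion P "\<lambda>s \<omega>. W s \<omega> - W 0 \<omega>" \<mu> by (rule centred_version)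
  have t0: "0 \<le> t" using t by simp
  note [measurable] = measurable_run_max[OF t0] V.measurable_run_max[OF t0]
    pred_exceeds_run_max[OF t0] V.pred_ever_exceeds[OF V.measurable_run_max[OF t0]]
  have "emeasure P {\<omega> \<in> space P. x < run_max t \<omega> \<and> \<not> (\<exists>s\<ge>0. run_max t \<omega> < W s \<omega>)}
      = emeasure P {\<omega> \<in> space P. x < V.run_max t \<omega> \<and> \<not> (\<exists>s\<ge>0. V.run_max t \<omega> < W s \<omega> - W 0 \<omega>)}"
  proof (rule emeasure_eq_AE)
    show "AE \<omega> in P. (\<omega> \<in> {\<omega> \<in> space P. x < run_max t \<omega> \<and> \<not> (\<exists>s\<ge>0. run_max t \<omega> < W s \<omega>)})
      = (\<omega> \<in> {\<omega> \<in> space P. x < V.run_max t \<omega> \<and> \<not> (\<exists>s\<ge>0. V.run_max t \<omega> < W s \<omega> - W 0 \<omega>)})"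
      using start_zero by eventually_elim (simp add: V.run_max_def run_max_def)
  qed measurable
  also note V.emeasure_run_max_final_centred[OF \<mu> t x]
  finally show ?thesis .
qed

end

section \<open>The joint and the conditional law\<close>

text \<open>The claimed joint density of \<open>(\<sigma>_M, M)\<close>, in the form in which it arises: an exponential density in
  \<open>x\<close> times the passage time density for the opposite drift.\<close>

definition peak_density :: "real \<Rightarrow> real \<times> real \<Rightarrow> real" where
  "peak_density \<mu> = (\<lambda>(t, x). if 0 < x then - 2 * \<mu> * exp (2 * \<mu> * x) * passage_density (- \<mu>) x t else 0)"

definition peak_measure :: "real \<Rightarrow> (real \<times> real) measure" where
  "peak_measure \<mu> = density (lborel \<Otimes>\<^sub>M lborel) (\<lambda>z. ennreal (peak_density \<mu> z))"

lemma sets_peak_measure[simp, measurable_cong]: "sets (peak_measure \<mu>) = sets (borel \<Otimes>\<^sub>M borel)"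
  unfolding peak_measure_def sets_density by (intro sets_pair_measure_cong sets_lborel)

lemma borel_measurable_peak_density[measurable]: "peak_density \<mu> \<in> borel_measurable (borel \<Otimes>\<^sub>M borel)"
proof -
  have [measurable]: "(\<lambda>z. passage_density (- \<mu>) (snd z) (fst z)) \<in> borel_measurable (borel \<Otimes>\<^sub>M borel)"
    using measurable_compose[of "\<lambda>z. (snd z, fst z)" "borel \<Otimes>\<^sub>M borel" "borel \<Otimes>\<^sub>M borel"
      "\<lambda>(x, t). passage_density (- \<mu>) x t" borel] by simp
  show ?thesis unfolding peak_density_def split_beta' by measurable
qed

lemma borel_measurable_passage_density_snd[measurable]: "passage_density \<mu> x \<in> borel_measurable borel"
  unfolding passage_density_def[abs_def] by measurable

lemma emeasure_peak_measure_Times: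
  assumes \<mu>: "\<mu> < 0" and [measurable]: "A \<in> sets borel" "B \<in> sets borel"
  shows "emeasure (peak_measure \<mu>) (A \<times> B) = (\<integral>\<^sup>+x. ennreal (- 2 * \<mu> * exp (2 * \<mu> * x)) * indicator {0<..} x
    * indicator B x * (\<integral>\<^sup>+t. ennreal (passage_density (- \<mu>) x t) * indicator A t \<partial>lborel) \<partial>lborel)"
proof -
  have m: "sets (lborel \<Otimes>\<^sub>M lborel) = sets (borel \<Otimes>\<^sub>M (borel :: real measure) :: (real \<times> real) measure)"
    by (intro sets_pair_measure_cong sets_lborel)
  have [measurable]: "peak_density \<mu> \<in> borel_measurable (lborel \<Otimes>\<^sub>M lborel)"
    using borel_measurable_peak_density[of \<mu>] measurable_cong_sets[OF m refl] by blast
  have AB: "A \<times> B \<in> sets (lborel \<Otimes>\<^sub>M lborel)" unfolding m by measurable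
  have "emeasure (peak_measure \<mu>) (A \<times> B)
      = (\<integral>\<^sup>+z. ennreal (peak_density \<mu> z) * indicator (A \<times> B) z \<partial>(lborel \<Otimes>\<^sub>M lborel))"
    unfolding peak_measure_def by (rule emeasure_density) (use AB in auto)
  also have "\<dots> = (\<integral>\<^sup>+x. (\<integral>\<^sup>+t. ennreal (peak_density \<mu> (t, x)) * indicator (A \<times> B) (t, x) \<partial>lborel) \<partial>lborel)"
    by (rule lborel_pair.nn_integral_snd[symmetric]) (use AB in measurable)
  also have "\<dots> = (\<integral>\<^sup>+x. ennreal (- 2 * \<mu> * exp (2 * \<mu> * x)) * indicator {0<..} x
    * indicator B x * (\<integral>\<^sup>+t. ennreal (passage_density (- \<mu>) x t) * indicator A t \<partial>lborel) \<partial>lborel)"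
  proof (rule nn_integral_cong)
    fix x :: real
    have "ennreal (peak_density \<mu> (t, x)) * indicator (A \<times> B) (t, x)
        = ennreal (- 2 * \<mu> * exp (2 * \<mu> * x)) * indicator {0<..} x * indicator B x
          * (ennreal (passage_density (- \<mu>) x t) * indicator A t)" for t
    proof (cases "0 < x \<and> t \<in> A \<and> x \<in> B")
      case True
      then show ?thesis using \<mu>
        by (simp add: peak_density_def ennreal_mult'[symmetric] mult_nonpos_nonneg)
    qed (auto simp: peak_density_def)
    then show "(\<integral>\<^sup>+t. ennreal (peak_density \<mu> (t, x)) * indicator (A \<times> B) (t, x) \<partial>lborel)
      = ennreal (- 2 * \<mu> * exp (2 * \<mu> * x)) * indicator {0<..} x
      * indicator B x * (\<integral>\<^sup>+t. ennreal (passage_density (- \<mu>) x t) * indicator A t \<partial>lborel)"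
      by (simp only:) (rule nn_integral_cmult, measurable)
  qed
  finally show ?thesis .
qed

lemma emeasure_peak_measure_rectangle:
  assumes \<mu>: "\<mu> < 0" and t: "0 < t" and x: "0 \<le> x"
  shows "emeasure (peak_measure \<mu>) ({..t} \<times> {x<..})
    = (\<integral>\<^sup>+y. ennreal (- 2 * \<mu> * exp (2 * \<mu> * y)) * ennreal (passage_cdf (- \<mu>) y t) * indicator {x<..} y \<partial>lborel)"
proof -
  have "ennreal (- 2 * \<mu> * exp (2 * \<mu> * y)) * indicator {0<..} y * indicator {x<..} y
      * (\<integral>\<^sup>+s. ennreal (passage_density (- \<mu>) y s) * indicator {..t} s \<partial>lborel)
    = ennreal (- 2 * \<mu> * exp (2 * \<mu> * y)) * ennreal (passage_cdf (- \<mu>) y t) * indicator {x<..} y" for y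
    using nn_integral_passage_density[of y t "- \<mu>"] x t by (auto split: split_indicator)
  then show ?thesis using \<mu> by (subst emeasure_peak_measure_Times) auto
qed

lemma emeasure_peak_measure_UNIV_Times:
  assumes \<mu>: "\<mu> < 0" and [measurable]: "B \<in> sets borel"
  shows "emeasure (peak_measure \<mu>) (UNIV \<times> B)
    = (\<integral>\<^sup>+x. ennreal (- 2 * \<mu> * exp (2 * \<mu> * x)) * indicator {0<..} x * indicator B x \<partial>lborel)"
proof -
  have "ennreal (- 2 * \<mu> * exp (2 * \<mu> * y)) * indicator {0<..} y * indicator B y
      * (\<integral>\<^sup>+s. ennreal (passage_density (- \<mu>) y s) * indicator UNIV s \<partial>lborel)
    = ennreal (- 2 * \<mu> * exp (2 * \<mu> * y)) * indicator {0<..} y * indicator B y" for y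
    using nn_integral_passage_density_total[of y "- \<mu>"] \<mu> by (auto split: split_indicator)
  then show ?thesis using \<mu> by (subst emeasure_peak_measure_Times) auto
qed

lemma emeasure_peak_measure_positive:
  assumes \<mu>: "\<mu> < 0"
  shows "emeasure (peak_measure \<mu>) (UNIV \<times> {0<..}) = 1"
proof -
  have "((\<lambda>x. - exp (2 * \<mu> * x)) \<longlongrightarrow> 0) at_top" using \<mu> by real_asymp
  then have "(\<integral>\<^sup>+x. ennreal (- 2 * \<mu> * exp (2 * \<mu> * x)) * indicator {0..} x \<partial>lborel) = ennreal (0 - - exp (2 * \<mu> * 0))"
    using \<mu> by (intro nn_integral_FTC_atLeast[where F = "\<lambda>x. - exp (2 * \<mu> * x)"])
      (auto intro!: derivative_eq_intros simp: mult_nonpos_nonneg)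
  moreover have "emeasure (peak_measure \<mu>) (UNIV \<times> {0<..})
      = (\<integral>\<^sup>+x. ennreal (- 2 * \<mu> * exp (2 * \<mu> * x)) * indicator {0..} x \<partial>lborel)"
    unfolding emeasure_peak_measure_UNIV_Times[OF \<mu> greaterThan_borel]
  proof (rule nn_integral_cong_AE)
    show "AE x in lborel. ennreal (- 2 * \<mu> * exp (2 * \<mu> * x)) * indicator {0<..} x * indicator {0<..} x
        = ennreal (- 2 * \<mu> * exp (2 * \<mu> * x)) * indicator {0..} x"
      using AE_lborel_singleton[of 0] by eventually_elim (auto split: split_indicator)
  qed
  ultimately show ?thesis by simp
qed

lemma peak_density_eq:
  "peak_density (- \<delta> / 2) (t, x) = (if 0 < t \<and> 0 < x
    then \<delta> * x / t powr (3 / 2) * std_normal_density (x / sqrt t + \<delta> / 2 * sqrt t) else 0)"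
proof (cases "0 < t \<and> 0 < x")
  case True
  have "std_normal_density (- x / sqrt t - \<delta> / 2 * sqrt t) = std_normal_density (x / sqrt t + \<delta> / 2 * sqrt t)"
    using power2_minus[of "x / sqrt t + \<delta> / 2 * sqrt t"] unfolding std_normal_density_def
    by (simp add: algebra_simps)
  then have "exp (- \<delta> * x) * std_normal_density (- x / sqrt t + \<delta> / 2 * sqrt t)
      = std_normal_density (x / sqrt t + \<delta> / 2 * sqrt t)"
    using std_normal_density_shift[of t "- \<delta> / 2" x] True by simp
  then show ?thesis using True
    by (simp add: peak_density_def passage_density_def)
next
  case False
  then show ?thesis by (auto simp: peak_density_def passage_density_def)
qed

context brownian_motion
begin

text \<open>The events that the maximum over \<open>[0, n]\<close> is positive and final have the probabilities
  \<open>emeasure (peak_measure \<mu>) ({..n} \<times> {0<..})\<close>.  These tend to the total mass 1, so almost surely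
  the maximum is attained and positive.  It cannot be attained at time 0, where the path is 0.\<close>
lemma AE_maximisers:
  assumes \<mu>: "\<mu> < 0"
  shows "AE \<omega> in P. maximisers \<omega> \<noteq> {} \<and> 0 < path_sup W \<omega> \<and> 0 < path_argsup W \<omega>"
proof -
  note [measurable] = path_sup_measurable
  define G where "G = {\<omega> \<in> space P. (\<exists>n::nat. \<not> (\<exists>s\<ge>0. run_max (real n) \<omega> < W s \<omega>)) \<and> 0 < path_sup W \<omega>}"
  have p: "Measurable.pred P (\<lambda>\<omega>. 0 < path_sup W \<omega>)" by measurable
  have G[measurable]: "G \<in> events"
    unfolding G_def by (intro predE pred_intros_logic pred_intros_countable pred_exceeds_run_max p) auto
  define C where "C n = {\<omega> \<in> space P. 0 < run_max (real (Suc n)) \<omega>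
    \<and> \<not> (\<exists>s\<ge>0. run_max (real (Suc n)) \<omega> < W s \<omega>)}" for n
  have "C n \<subseteq> G" for n
  proof
    fix \<omega> assume \<omega>: "\<omega> \<in> C n"
    then have "\<omega> \<in> space P" "0 < run_max (real (Suc n)) \<omega>"
        and peak: "\<not> (\<exists>s\<ge>0. run_max (real (Suc n)) \<omega> < W s \<omega>)"
      unfolding C_def by blast+
    moreover from this have "path_sup W \<omega> = run_max (real (Suc n)) \<omega>"
      by (intro path_sup_eq_run_max) auto
    ultimately show "\<omega> \<in> G" unfolding G_def by (intro CollectI conjI exI[of _ "Suc n"]) simp_all
  qed
  then have le: "emeasure (peak_measure \<mu>) ({..real (Suc n)} \<times> {0<..}) \<le> emeasure P G" for n
    using emeasure_mono[OF _ G, of "C n"] emeasure_run_max_final[OF \<mu>, of "real (Suc n)" 0]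
      emeasure_peak_measure_rectangle[OF \<mu>, of "real (Suc n)" 0]
    unfolding C_def by simp
  have "(\<lambda>n. emeasure (peak_measure \<mu>) ({..real (Suc n)} \<times> {0<..})) \<longlonglongrightarrow>
      emeasure (peak_measure \<mu>) (\<Union>n. {..real (Suc n)} \<times> {0<..})"
    by (rule Lim_emeasure_incseq) (auto simp: incseq_def)
  also have "(\<Union>n. {..real (Suc n)} \<times> {0<..}) = (UNIV \<times> {0<..} :: (real \<times> real) set)"
  proof -
    have "\<exists>n. s \<le> real (Suc n)" for s
    proof -
      obtain n where "s \<le> real n" using real_arch_simple by blast
      then show ?thesis by (intro exI[of _ n]) simp
    qed
    then show ?thesis by auto
  qed
  finally have "1 \<le> emeasure P G"
    unfolding emeasure_peak_measure_positive[OF \<mu>] by (rule LIMSEQ_le_const2) (use le in blast)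
  then have "prob G = 1"
    using prob_le_1[of G] by (simp add: emeasure_eq_measure)
  then have "AE \<omega> in P. \<omega> \<in> G" by (rule AE_prob_1)
  then show ?thesis
    using start_zero AE_space
  proof eventually_elim
    case (elim \<omega>)
    have ne: "maximisers \<omega> \<noteq> {}"
      using elim maximisers_nonempty_iff[of \<omega>] unfolding G_def by blast
    have pos: "0 < path_sup W \<omega>" using elim unfolding G_def by blast
    have mem: "path_argsup W \<omega> \<in> maximisers \<omega>" by (rule path_argsup_in_maximisers) fact+
    then have "path_sup W \<omega> = W (path_argsup W \<omega>) \<omega>" by (rule path_sup_eq_maximum)
    then have "path_argsup W \<omega> \<noteq> 0" using pos elim by auto
    moreover have "0 \<le> path_argsup W \<omega>" using mem by (simp add: maximisers_iff)
    ultimately show ?case using ne pos by simp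
  qed
qed

lemma emeasure_argsup_sup_rectangle:
  assumes \<mu>: "\<mu> < 0"
  shows "emeasure P {\<omega> \<in> space P. path_argsup W \<omega> \<le> t \<and> x < path_sup W \<omega>}
    = emeasure (peak_measure \<mu>) ({..t} \<times> {x<..})"
proof -
  note [measurable] = path_sup_measurable path_argsup_measurable
  show ?thesis
  proof (cases "0 < t")
    case False
    have "emeasure P {\<omega> \<in> space P. path_argsup W \<omega> \<le> t \<and> x < path_sup W \<omega>} = emeasure P {}"
    proof (rule emeasure_eq_AE)
      show "AE \<omega> in P. (\<omega> \<in> {\<omega> \<in> space P. path_argsup W \<omega> \<le> t \<and> x < path_sup W \<omega>}) = (\<omega> \<in> {})"
        using AE_maximisers[OF \<mu>] by eventually_elim (use False in auto)
    qed measurable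
    moreover have "emeasure (peak_measure \<mu>) ({..t} \<times> {x<..}) = 0"
    proof -
      have "(\<integral>\<^sup>+s. ennreal (passage_density (- \<mu>) y s) * indicator {..t} s \<partial>lborel) = (\<integral>\<^sup>+s. 0 \<partial>(lborel::real measure))" for y
        using False by (intro nn_integral_cong) (auto simp: passage_density_def split: split_indicator)
      then show ?thesis by (subst emeasure_peak_measure_Times[OF \<mu>]) auto
    qed
    ultimately show ?thesis by simp
  next
    case True
    \<comment> \<open>The maximum is almost surely positive, so a negative level is as good as 0.\<close>
    let ?x = "max 0 x"
    have [measurable]: "Measurable.pred P (\<lambda>\<omega>. \<exists>s\<ge>0. run_max t \<omega> < W s \<omega>)" "run_max t \<in> borel_measurable P"
      using True by (auto intro!: pred_exceeds_run_max measurable_run_max)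
    have "emeasure P {\<omega> \<in> space P. path_argsup W \<omega> \<le> t \<and> x < path_sup W \<omega>}
        = emeasure P {\<omega> \<in> space P. ?x < run_max t \<omega> \<and> \<not> (\<exists>s\<ge>0. run_max t \<omega> < W s \<omega>)}"
    proof (rule emeasure_eq_AE)
      show "AE \<omega> in P. (\<omega> \<in> {\<omega> \<in> space P. path_argsup W \<omega> \<le> t \<and> x < path_sup W \<omega>})
          = (\<omega> \<in> {\<omega> \<in> space P. ?x < run_max t \<omega> \<and> \<not> (\<exists>s\<ge>0. run_max t \<omega> < W s \<omega>)})"
        using AE_maximisers[OF \<mu>] AE_space
      proof eventually_elim
        case (elim \<omega>)
        have 1: "path_argsup W \<omega> \<le> t \<longleftrightarrow> \<not> (\<exists>s\<ge>0. run_max t \<omega> < W s \<omega>)"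
          using elim True by (intro path_argsup_le_iff) auto
        have 2: "path_sup W \<omega> = run_max t \<omega>" if "\<not> (\<exists>s\<ge>0. run_max t \<omega> < W s \<omega>)"
          using elim True that by (intro path_sup_eq_run_max) auto
        have "x < path_sup W \<omega> \<longleftrightarrow> ?x < path_sup W \<omega>" using elim by auto
        then have "path_argsup W \<omega> \<le> t \<and> x < path_sup W \<omega> \<longleftrightarrow>
            ?x < run_max t \<omega> \<and> \<not> (\<exists>s\<ge>0. run_max t \<omega> < W s \<omega>)"
          unfolding 1 using 2 by (cases "\<exists>s\<ge>0. run_max t \<omega> < W s \<omega>") argo+
        then show ?case unfolding mem_Collect_eq by blast
      qed
    qed measurable
    also have "\<dots> = emeasure (peak_measure \<mu>) ({..t} \<times> {?x<..})"
      using True emeasure_run_max_final[OF \<mu> True, of ?x]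
        emeasure_peak_measure_rectangle[OF \<mu> True, of ?x] by simp
    also have "\<dots> = emeasure (peak_measure \<mu>) ({..t} \<times> {x<..})"
      unfolding emeasure_peak_measure_Times[OF \<mu> atMost_borel greaterThan_borel]
      by (intro nn_integral_cong) (auto split: split_indicator)
    finally show ?thesis .
  qed
qed

lemma measurable_argsup_sup: "(\<lambda>\<omega>. (path_argsup W \<omega>, path_sup W \<omega>)) \<in> P \<rightarrow>\<^sub>M borel \<Otimes>\<^sub>M borel"
  by (intro measurable_Pair path_argsup_measurable path_sup_measurable)

text \<open>The rectangles \<open>{..t} \<times> {x<..}\<close> are stable under intersection and generate the Borel sets of the
  plane.\<close>
lemma distr_argsup_sup:
  assumes \<mu>: "\<mu> < 0"
  shows "distr P (borel \<Otimes>\<^sub>M borel) (\<lambda>\<omega>. (path_argsup W \<omega>, path_sup W \<omega>)) = peak_measure \<mu>"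
    (is "?D = _")
proof -
  let ?E1 = "range (\<lambda>t::real. {..t})" and ?E2 = "range (\<lambda>x::real. {x<..})"
  let ?E = "{A \<times> B |A B. A \<in> ?E1 \<and> B \<in> ?E2}"
  let ?C1 = "range (\<lambda>n::nat. {..real n})" and ?C2 = "range (\<lambda>n::nat. {- real n<..})"
  have C1: "\<Union> ?C1 = UNIV" and C2: "\<Union> ?C2 = UNIV"
    using real_arch_simple reals_Archimedean2 by (auto simp: minus_less_iff)
  have b1: "sets borel = sigma_sets UNIV ?E1" by (subst borel_eq_atMost) simp
  have b2: "sets borel = sigma_sets UNIV ?E2" by (subst borel_Ioi) simp
  have "sets ((borel :: real measure) \<Otimes>\<^sub>M (borel :: real measure)) = sets (sigma (space borel \<times> space borel) ?E)"
    by (rule sets_pair_eq[where Ca = ?C1 and Cb = ?C2]) (use b1 b2 C1 C2 in auto)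
  then have sets: "sets ((borel :: real measure) \<Otimes>\<^sub>M (borel :: real measure)) = sigma_sets UNIV ?E" by simp
  show ?thesis
  proof (rule measure_eqI_generator_eq[where E = ?E and \<Omega> = UNIV and A = "\<lambda>n::nat. {..real n} \<times> {- real n<..}"])
    show "Int_stable ?E"
    proof (rule Int_stableI)
      fix a b assume "a \<in> ?E" "b \<in> ?E"
      then obtain t x t' x' where ab: "a = {..t} \<times> {x<..}" "b = {..t'} \<times> {x'<..}" by auto
      have "a \<inter> b = {..min t t'} \<times> {max x x'<..}" unfolding ab by auto
      then show "a \<inter> b \<in> ?E" by blast
    qed
    show "sets ?D = sigma_sets UNIV ?E" "sets (peak_measure \<mu>) = sigma_sets UNIV ?E"
      using sets by simp_all
    show "emeasure ?D A = emeasure (peak_measure \<mu>) A" if "A \<in> ?E" for A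
    proof -
      obtain t x where A: "A = {..t} \<times> {x<..}" using \<open>A \<in> ?E\<close> by auto
      have "emeasure ?D A = emeasure P ((\<lambda>\<omega>. (path_argsup W \<omega>, path_sup W \<omega>)) -` A \<inter> space P)"
        by (rule emeasure_distr[OF measurable_argsup_sup]) (simp add: A)
      also have "(\<lambda>\<omega>. (path_argsup W \<omega>, path_sup W \<omega>)) -` A \<inter> space P
          = {\<omega> \<in> space P. path_argsup W \<omega> \<le> t \<and> x < path_sup W \<omega>}"
        by (auto simp: A)
      finally show ?thesis unfolding A emeasure_argsup_sup_rectangle[OF \<mu>] .
    qed
    show "(\<Union>n::nat. {..real n} \<times> {- real n<..}) = UNIV"
    proof -
      have "\<exists>n::nat. t \<le> real n \<and> - real n < x" for t x :: real
      proof -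
        obtain n where "max t (- x) < real n" using reals_Archimedean2 by blast
        then show ?thesis by (intro exI[of _ n]) auto
      qed
      then show ?thesis by auto
    qed
    interpret D: prob_space ?D by (rule prob_space_distr[OF measurable_argsup_sup])
    show "emeasure ?D ({..real n} \<times> {- real n<..}) \<noteq> \<infinity>" for n by simp
  qed auto
qed

lemma distr_path_sup:
  assumes \<mu>: "\<mu> < 0"
  shows "distr P borel (path_sup W) = density lborel (\<lambda>x. ennreal (- 2 * \<mu> * exp (2 * \<mu> * x)) * indicator {0<..} x)"
proof (rule measure_eqI)
  fix B assume "B \<in> sets (distr P borel (path_sup W))"
  then have B[measurable]: "B \<in> sets borel" by simp
  have "emeasure (distr P borel (path_sup W)) B = emeasure P (path_sup W -` B \<inter> space P)"
    by (rule emeasure_distr[OF path_sup_measurable B])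
  also have "\<dots> = emeasure P ((\<lambda>\<omega>. (path_argsup W \<omega>, path_sup W \<omega>)) -` (UNIV \<times> B) \<inter> space P)"
    by (intro arg_cong[where f = "emeasure P"]) auto
  also have "\<dots> = emeasure (peak_measure \<mu>) (UNIV \<times> B)"
    unfolding distr_argsup_sup[OF \<mu>, symmetric]
    by (rule emeasure_distr[OF measurable_argsup_sup, symmetric]) measurable
  also have "\<dots> = emeasure (density lborel (\<lambda>x. ennreal (- 2 * \<mu> * exp (2 * \<mu> * x)) * indicator {0<..} x)) B"
    unfolding emeasure_peak_measure_UNIV_Times[OF \<mu> B] by (subst emeasure_density) auto
  finally show "emeasure (distr P borel (path_sup W)) B
      = emeasure (density lborel (\<lambda>x. ennreal (- 2 * \<mu> * exp (2 * \<mu> * x)) * indicator {0<..} x)) B" .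
qed simp

end

text \<open>The law of the passage time of level \<open>x\<close>.  Levels \<open>x \<le> 0\<close> have probability 0 under the law of the
  maximum; there any probability measure makes the kernel total.\<close>
definition passage_kernel :: "real \<Rightarrow> real \<Rightarrow> real measure" where
  "passage_kernel \<mu> x = (if 0 < x then density lborel (\<lambda>t. ennreal (passage_density \<mu> x t)) else return borel 0)"

lemma sets_passage_kernel[simp]: "sets (passage_kernel \<mu> x) = sets borel"
  by (simp add: passage_kernel_def)

lemma emeasure_passage_kernel:
  "0 < x \<Longrightarrow> A \<in> sets borel \<Longrightarrow>
    emeasure (passage_kernel \<mu> x) A = (\<integral>\<^sup>+t. ennreal (passage_density \<mu> x t) * indicator A t \<partial>lborel)"
  by (simp add: passage_kernel_def emeasure_density)

lemma prob_space_passage_kernel: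
  assumes "0 < \<mu>" shows "prob_space (passage_kernel \<mu> x)"
proof (cases "0 < x")
  case True
  then show ?thesis
    using nn_integral_passage_density_total[of x \<mu>] assms
    by (intro prob_spaceI) (simp add: passage_kernel_def emeasure_density)
qed (simp add: passage_kernel_def prob_space_return)

lemma measurable_passage_kernel:
  assumes "0 < \<mu>" shows "passage_kernel \<mu> \<in> borel \<rightarrow>\<^sub>M prob_algebra borel"
proof (intro measurable_prob_algebraI measurable_subprob_algebra)
  show "prob_space (passage_kernel \<mu> x)" "subprob_space (passage_kernel \<mu> x)" for x
    using prob_space_passage_kernel[OF assms] prob_space_imp_subprob_space by auto
  fix A :: "real set" assume [measurable]: "A \<in> sets borel"
  have [measurable]: "(\<lambda>(x, t). ennreal (passage_density \<mu> x t) * indicator A t) \<in> borel_measurable (borel \<Otimes>\<^sub>M lborel)"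
  proof -
    have "(\<lambda>(x, t). ennreal (passage_density \<mu> x t) * indicator A t) \<in> borel_measurable (borel \<Otimes>\<^sub>M borel)"
      using borel_measurable_passage_density[of \<mu>] unfolding split_beta' by measurable
    moreover have "sets (borel \<Otimes>\<^sub>M lborel) = sets (borel \<Otimes>\<^sub>M borel :: (real \<times> real) measure)"
      by (intro sets_pair_measure_cong) auto
    ultimately show ?thesis using measurable_cong_sets by blast
  qed
  have "(\<lambda>x. if 0 < x then (\<integral>\<^sup>+t. ennreal (passage_density \<mu> x t) * indicator A t \<partial>lborel) else emeasure (return borel (0::real)) A)
      \<in> borel_measurable borel"
    by measurable
  also have "?this \<longleftrightarrow> (\<lambda>x. emeasure (passage_kernel \<mu> x) A) \<in> borel_measurable borel"
    by (intro measurable_cong) (auto simp: passage_kernel_def emeasure_density)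
  finally show "(\<lambda>x. emeasure (passage_kernel \<mu> x) A) \<in> borel_measurable borel" .
qed simp

lemma measure_passage_kernel_lessThan:
  assumes "0 < x" "0 < t"
  shows "measure (passage_kernel \<mu> x) {..<t} = passage_cdf \<mu> x t"
proof -
  have "emeasure (passage_kernel \<mu> x) {..<t} = (\<integral>\<^sup>+s. ennreal (passage_density \<mu> x s) * indicator {..<t} s \<partial>lborel)"
    using assms by (simp add: emeasure_passage_kernel)
  also have "\<dots> = (\<integral>\<^sup>+s. ennreal (passage_density \<mu> x s) * indicator {..t} s \<partial>lborel)"
  proof (rule nn_integral_cong_AE)
    show "AE s in lborel. ennreal (passage_density \<mu> x s) * indicator {..<t} s
        = ennreal (passage_density \<mu> x s) * indicator {..t} s"
      using AE_lborel_singleton[of t] by eventually_elim (auto split: split_indicator)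
  qed
  also have "\<dots> = ennreal (passage_cdf \<mu> x t)" by (rule nn_integral_passage_density[OF assms])
  finally show ?thesis by (simp add: measure_def passage_cdf_nonneg)
qed

lemma (in brownian_motion) regular_cond_distr_argsup:
  assumes \<mu>: "\<mu> < 0"
  shows "regular_cond_distr P borel (path_argsup W) borel (path_sup W) (passage_kernel (- \<mu>))"
  unfolding regular_cond_distr_def
proof (intro conjI ballI)
  show "path_argsup W \<in> borel_measurable P" "path_sup W \<in> borel_measurable P"
    by (rule path_argsup_measurable path_sup_measurable)+
  show K: "passage_kernel (- \<mu>) \<in> borel \<rightarrow>\<^sub>M prob_algebra borel"
    using \<mu> by (intro measurable_passage_kernel) simp
  fix A B :: "real set" assume A[measurable]: "A \<in> sets borel" and B[measurable]: "B \<in> sets borel"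
  have KA[measurable]: "(\<lambda>x. emeasure (passage_kernel (- \<mu>) x) A) \<in> borel_measurable borel"
    using measurable_compose[OF measurable_prob_algebraD[OF K] measurable_emeasure_subprob_algebra[OF A]] .
  have "emeasure P {\<omega> \<in> space P. path_argsup W \<omega> \<in> A \<and> path_sup W \<omega> \<in> B}
      = emeasure P ((\<lambda>\<omega>. (path_argsup W \<omega>, path_sup W \<omega>)) -` (A \<times> B) \<inter> space P)"
    by (intro arg_cong[where f = "emeasure P"]) auto
  also have "\<dots> = emeasure (peak_measure \<mu>) (A \<times> B)"
    unfolding distr_argsup_sup[OF \<mu>, symmetric]
    by (rule emeasure_distr[OF measurable_argsup_sup, symmetric]) measurable
  also have "\<dots> = (\<integral>\<^sup>+x. ennreal (- 2 * \<mu> * exp (2 * \<mu> * x)) * indicator {0<..} x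
      * (emeasure (passage_kernel (- \<mu>) x) A * indicator B x) \<partial>lborel)"
    unfolding emeasure_peak_measure_Times[OF \<mu> A B]
  proof (rule nn_integral_cong)
    fix x
    show "ennreal (- 2 * \<mu> * exp (2 * \<mu> * x)) * indicator {0<..} x * indicator B x
        * (\<integral>\<^sup>+t. ennreal (passage_density (- \<mu>) x t) * indicator A t \<partial>lborel)
      = ennreal (- 2 * \<mu> * exp (2 * \<mu> * x)) * indicator {0<..} x
        * (emeasure (passage_kernel (- \<mu>) x) A * indicator B x)"
      using emeasure_passage_kernel[OF _ A, of x "- \<mu>"] by (auto simp: mult_ac split: split_indicator)
  qed
  also have "\<dots> = (\<integral>\<^sup>+x\<in>B. emeasure (passage_kernel (- \<mu>) x) A \<partial>distr P borel (path_sup W))"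
    unfolding distr_path_sup[OF \<mu>] by (rule nn_integral_density[symmetric]) auto
  finally show "emeasure P {\<omega> \<in> space P. path_argsup W \<omega> \<in> A \<and> path_sup W \<omega> \<in> B}
      = (\<integral>\<^sup>+x\<in>B. emeasure (passage_kernel (- \<mu>) x) A \<partial>distr P borel (path_sup W))" .
qed

theorem theorem2:
  fixes P Ps :: "'a measure" and W :: "real \<Rightarrow> 'a \<Rightarrow> real" and \<delta> :: real
  assumes "\<delta> > 0"
    and "sets Ps = sets P"
    and "brownian_motion P W (- \<delta> / 2)"
    and "brownian_motion Ps W (\<delta> / 2)"
  shows "(\<exists>K. regular_cond_distr P borel (path_argsup W) borel (path_sup W) K \<and>
      (\<forall>x>0. \<forall>t>0.
          measure (K x) {..<t} = \<P>(\<omega> in Ps. passage_time W x \<omega> < ereal t) \<and>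
          \<P>(\<omega> in Ps. passage_time W x \<omega> < ereal t)
            = exp (\<delta> * x) * std_normal_cdf (- x / sqrt t - \<delta> / 2 * sqrt t)
              + std_normal_cdf (- x / sqrt t + \<delta> / 2 * sqrt t)) \<and>
      (\<forall>x>0. K x = density lborel (\<lambda>t. ennreal
          (if 0 < t then x / t powr (3 / 2) * std_normal_density (- x / sqrt t + \<delta> / 2 * sqrt t)
           else 0)))) \<and>
    distributed P (lborel \<Otimes>\<^sub>M lborel) (\<lambda>\<omega>. (path_argsup W \<omega>, path_sup W \<omega>))
      (\<lambda>(t, x). ennreal
          (if 0 < t \<and> 0 < x
           then \<delta> * x / t powr (3 / 2) * std_normal_density (x / sqrt t + \<delta> / 2 * sqrt t)
           else 0))"
proof -
  interpret P: brownian_motion P W "- \<delta> / 2" by fact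
  interpret Ps: brownian_motion Ps W "\<delta> / 2" by fact
  have \<mu>: "- \<delta> / 2 < 0" using assms(1) by simp
  have cond: "regular_cond_distr P borel (path_argsup W) borel (path_sup W) (passage_kernel (\<delta> / 2))"
    using P.regular_cond_distr_argsup[OF \<mu>] by simp
  have cdf: "\<P>(\<omega> in Ps. passage_time W x \<omega> < ereal t) = passage_cdf (\<delta> / 2) x t"
    if "0 < x" "0 < t" for x t
    using that by (intro Ps.prob_passage_time_less) auto
  have kernel: "measure (passage_kernel (\<delta> / 2) x) {..<t} = passage_cdf (\<delta> / 2) x t"
    if "0 < x" "0 < t" for x t
    using that by (rule measure_passage_kernel_lessThan)
  have dens: "passage_kernel (\<delta> / 2) x = density lborel (\<lambda>t. ennreal
      (if 0 < t then x / t powr (3 / 2) * std_normal_density (- x / sqrt t + \<delta> / 2 * sqrt t) else 0))"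
    if "0 < x" for x
    using that by (simp add: passage_kernel_def passage_density_def)
  let ?f = "\<lambda>(t, x). ennreal (if 0 < t \<and> 0 < x
    then \<delta> * x / t powr (3 / 2) * std_normal_density (x / sqrt t + \<delta> / 2 * sqrt t) else 0)"
  have f: "?f = (\<lambda>z. ennreal (peak_density (- \<delta> / 2) z))"
  proof (rule ext)
    show "?f z = ennreal (peak_density (- \<delta> / 2) z)" for z
      by (cases z) (simp only: split peak_density_eq)
  qed
  have sets: "sets (lborel \<Otimes>\<^sub>M lborel) = sets (borel \<Otimes>\<^sub>M borel :: (real \<times> real) measure)"
    by (intro sets_pair_measure_cong sets_lborel)
  have joint: "distributed P (lborel \<Otimes>\<^sub>M lborel) (\<lambda>\<omega>. (path_argsup W \<omega>, path_sup W \<omega>)) ?f"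
    unfolding distributed_def
  proof (intro conjI)
    show "(\<lambda>\<omega>. (path_argsup W \<omega>, path_sup W \<omega>)) \<in> P \<rightarrow>\<^sub>M lborel \<Otimes>\<^sub>M lborel"
      using P.measurable_argsup_sup measurable_cong_sets[OF refl sets] by blast
    show "?f \<in> borel_measurable (lborel \<Otimes>\<^sub>M lborel)"
      unfolding f measurable_cong_sets[OF sets refl] by measurable
    have "distr P (lborel \<Otimes>\<^sub>M lborel) (\<lambda>\<omega>. (path_argsup W \<omega>, path_sup W \<omega>))
        = distr P (borel \<Otimes>\<^sub>M borel) (\<lambda>\<omega>. (path_argsup W \<omega>, path_sup W \<omega>))"
      using sets by (intro distr_cong) auto
    then show "distr P (lborel \<Otimes>\<^sub>M lborel) (\<lambda>\<omega>. (path_argsup W \<omega>, path_sup W \<omega>)) = density (lborel \<Otimes>\<^sub>M lborel) ?f"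
      unfolding f P.distr_argsup_sup[OF \<mu>] peak_measure_def .
  qed
  show ?thesis
  proof (intro conjI exI[of _ "passage_kernel (\<delta> / 2)"] allI impI cond joint dens)
    fix x t :: real assume xt: "0 < x" "0 < t"
    show "measure (passage_kernel (\<delta> / 2) x) {..<t} = \<P>(\<omega> in Ps. passage_time W x \<omega> < ereal t)"
      unfolding cdf[OF xt] kernel[OF xt] ..
    show "\<P>(\<omega> in Ps. passage_time W x \<omega> < ereal t)
        = exp (\<delta> * x) * std_normal_cdf (- x / sqrt t - \<delta> / 2 * sqrt t)
          + std_normal_cdf (- x / sqrt t + \<delta> / 2 * sqrt t)"
      unfolding cdf[OF xt] passage_cdf_def by simp
  qed
qed

end
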